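(* Let $n=pr$, where $p$ and $r$ are distinct odd primes such that $p$ is a generator of the multiplicative group $\mathbf{Z}_r^*$ and $p>\Gamma_r$. Let $\zeta_n$ be a primitive $n$-th root of unity in $\mathbf{C}$. If $I,J\subseteq\mathbf{Z}_n$ satisfy $|I_r^k|=|J_r^k|$ for all $k=0,1,\dots,r-1$, then the matrix $(\zeta_n^{ij})_{i\in I,\, j\in J}$ has nonzero determinant.
   Context: Via the group isomorphism $\mathbf{Z}_p\times\mathbf{Z}_r\to\mathbf{Z}_{pr}$, $(i_p,i_r)\mapsto i\equiv r\,i_p+p\,i_r\pmod{pr}$, every $i\in\mathbf{Z}_{pr}$ has components $i_p\in\mathbf{Z}_p$, $i_r\in\mathbf{Z}_r$ (so $i\equiv p\,i_r\pmod r$). For $I\subseteq\mathbf{Z}_{pr}$ and $k\in\{0,\dots,r-1\}$, $I_r^k=\{i\in I: i_r=k\}$. The constant $\Gamma_r$: for variables $x_1,\dots,x_m$ let $V_m(x_1,\dots,x_m)=\det(x_i^{j-1})_{1\le i,j\le m}$ be the Vandermonde determinant. For $2\le m\le r-1$ put $\gamma_m=\max\{V_m(a_1,\dots,a_m)/V_m(0,1,\dots,m-1): a_1<a_2<\dots<a_m \text{ integers in } [0,r-1]\}$, and $\Gamma_r=\max\{\gamma_m: 2\le m\le r-1\}$. *)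

theory Defs
  imports
    "HOL-Number_Theory.Residue_Primitive_Roots"
    "Jordan_Normal_Form.Determinant"
    "Jordan_Normal_Form.DL_Submatrix"
begin

text \<open>
  The ring of integers modulo \<open>n\<close> is represented by its least residues \<open>{..<n} :: nat set\<close>.
\<close>

definition crt_iso :: "nat \<Rightarrow> nat \<Rightarrow> nat \<times> nat \<Rightarrow> nat" where
  "crt_iso p r = (\<lambda>(ip, ir). (r * ip + p * ir) mod (p * r))"

lemma bij_betw_crt_iso:
  assumes "coprime p r" and "p > 0" and "r > 0"
  shows "bij_betw (crt_iso p r) ({..<p} \<times> {..<r}) {..<p * r}"
proof -
  have inj: "inj_on (crt_iso p r) ({..<p} \<times> {..<r})"
  proof (rule inj_onI, clarsimp simp: crt_iso_def)
    fix a b c d :: nat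
    assume lt: "a < p" "b < r" "c < p" "d < r"
      and eq: "(r * a + p * b) mod (p * r) = (r * c + p * d) mod (p * r)"
    have "(r * a + p * b) mod p = (r * c + p * d) mod p"
      using arg_cong[OF eq, of "\<lambda>x. x mod p"] by (simp add: mod_mod_cancel del: mod_mult_self4)
    moreover have "(r * a + p * b) mod r = (r * c + p * d) mod r"
      using arg_cong[OF eq, of "\<lambda>x. x mod r"] by (simp add: mod_mod_cancel del: mod_mult_self4)
    ultimately have "[r * a = r * c] (mod p)" "[p * b = p * d] (mod r)"
      by (simp_all add: cong_def)
    then have "[a = c] (mod p)" "[b = d] (mod r)"
      using assms(1) by (simp_all add: cong_mult_lcancel_nat coprime_commute)
    then show "a = c \<and> b = d"
      using lt by (simp add: cong_less_modulus_unique_nat)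
  qed
  moreover have "crt_iso p r ` ({..<p} \<times> {..<r}) = {..<p * r}"
  proof (rule card_subset_eq)
    show "crt_iso p r ` ({..<p} \<times> {..<r}) \<subseteq> {..<p * r}"
      using assms by (auto simp: crt_iso_def)
  qed (simp_all add: card_image[OF inj] card_cartesian_product)
  ultimately show ?thesis
    by (simp add: bij_betw_def)
qed

definition r_component :: "nat \<Rightarrow> nat \<Rightarrow> nat \<Rightarrow> nat" where
  "r_component p r i = snd (inv_into ({..<p} \<times> {..<r}) (crt_iso p r) i)"

definition r_slice :: "nat \<Rightarrow> nat \<Rightarrow> nat set \<Rightarrow> nat \<Rightarrow> nat set" where
  "r_slice p r I k = {i \<in> I. r_component p r i = k}"

definition vandermonde_det :: "'a :: comm_ring_1 list \<Rightarrow> 'a" where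
  "vandermonde_det xs = det (mat (length xs) (length xs) (\<lambda>(i, j). (xs ! i) ^ j))"

definition increasing_tuples :: "nat \<Rightarrow> nat \<Rightarrow> nat list set" where
  "increasing_tuples r m = {a. length a = m \<and> sorted_wrt (<) a \<and> set a \<subseteq> {0..r - 1}}"

definition gamma_const :: "nat \<Rightarrow> nat \<Rightarrow> real" where
  "gamma_const r m =
     Max ((\<lambda>a. vandermonde_det (map real a) / vandermonde_det (map real [0..<m]))
            ` increasing_tuples r m)"

definition Gamma_const :: "nat \<Rightarrow> real" where
  "Gamma_const r = Max (gamma_const r ` {2..r - 1})"

text \<open>The maximum defining \<open>gamma_const\<close> ranges over a finite nonempty set.\<close>

lemma finite_increasing_tuples: "finite (increasing_tuples r m)"
  by (rule finite_subset[OF _ finite_lists_length_eq[of "{0..r - 1}" m]])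
     (auto simp: increasing_tuples_def)

lemma increasing_tuples_nonempty: "m \<le> r \<Longrightarrow> [0..<m] \<in> increasing_tuples r m"
  by (auto simp: increasing_tuples_def)

definition primitive_root_of_unity :: "nat \<Rightarrow> complex \<Rightarrow> bool" where
  "primitive_root_of_unity n z \<longleftrightarrow> z ^ n = 1 \<and> (\<forall>k. 0 < k \<and> k < n \<longrightarrow> z ^ k \<noteq> 1)"

definition fourier_mat :: "nat \<Rightarrow> complex \<Rightarrow> complex mat" where
  "fourier_mat n z = mat n n (\<lambda>(i, j). z ^ (i * j))"

end

theory Submission
  imports Defs
begin

text \<open>
  Choose a valuation ring \<open>V\<close> of the complex numbers whose maximal ideal \<open>Q\<close> contains \<open>p\<close>.
  By the Chinese remainder theorem \<open>\<zeta> ^ (i * j) = w ^ (i\<^sub>p * j\<^sub>p) * x ^ (i\<^sub>r * j\<^sub>r)\<close>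
  with \<open>w\<close> a primitive \<open>p\<close>-th and \<open>x\<close> a primitive \<open>r\<close>-th root of unity, and \<open>w\<close> is congruent
  to \<open>1\<close> modulo \<open>Q\<close>. If the determinant vanishes, scale a kernel vector \<open>c\<close> so that its entries lie
  in \<open>V\<close> but not all in \<open>Q\<close>. For every \<open>l\<close> the polynomial
  \<open>f\<^sub>l = \<Sum>\<^sub>j c\<^sub>j x ^ (l * j\<^sub>r) X ^ j\<^sub>p\<close> has \<open>card (I\<^sub>r\<^sup>l)\<close> distinct roots congruent to \<open>1\<close>, so modulo \<open>Q\<close>
  it has a zero of that order at \<open>1\<close>; hence its first \<open>card (I\<^sub>r\<^sup>l)\<close> moments
  \<open>\<Sum>\<^sub>e (coeff f\<^sub>l e) * e ^ t\<close> lie in \<open>Q\<close>. For each \<open>t\<close> this is a linear system for the \<open>t\<close>-th moments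
  of the slices of \<open>c\<close>, whose matrix is a principal minor \<open>(x ^ (l * k))\<close>, since both slice sizes
  agree. If these minors are nonzero modulo \<open>Q\<close>, induction on \<open>t\<close> puts all moments of all slices,
  and therefore all \<open>c\<^sub>j\<close>, into \<open>Q\<close>, a contradiction.

  The minor with exponents \<open>a\<close> is a Vandermonde product times the value at \<open>x\<close> of a specialised Schur
  polynomial: a polynomial with nonnegative integer coefficients whose sum
  \<open>N = V(a) / V(0, \<dots>, m - 1)\<close> is less than \<open>p\<close> and not divisible by \<open>r\<close>. If such a polynomial vanished
  at \<open>x\<close> modulo \<open>Q\<close>, it would vanish, by Frobenius and because \<open>p\<close> generates the units modulo
  \<open>r\<close>, at all nontrivial \<open>r\<close>-th roots of unity; its coefficient sums over the residue classes
  modulo \<open>r\<close> would then be congruent modulo \<open>p\<close>, hence equal, and \<open>r\<close> would divide \<open>N\<close>.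
\<close>

section \<open>Valuation rings\<close>

text \<open>\<open>Q\<close> is the maximal ideal of \<open>V\<close>: a proper ideal such that
  every element of \<open>V\<close> outside it is a unit. Both sets are kept explicit so that
  reduction modulo \<open>Q\<close> needs no quotient type.\<close>

locale valuation_ring =
  fixes V Q :: "'a::field set"
  assumes one_V: "1 \<in> V"
    and minus_V: "\<And>x y. x \<in> V \<Longrightarrow> y \<in> V \<Longrightarrow> x - y \<in> V"
    and times_V: "\<And>x y. x \<in> V \<Longrightarrow> y \<in> V \<Longrightarrow> x * y \<in> V"
    and Q_subset_V: "Q \<subseteq> V"
    and zero_Q: "0 \<in> Q"
    and minus_Q: "\<And>x y. x \<in> Q \<Longrightarrow> y \<in> Q \<Longrightarrow> x - y \<in> Q"
    and times_V_Q: "\<And>x y. x \<in> V \<Longrightarrow> y \<in> Q \<Longrightarrow> x * y \<in> Q"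
    and one_notin_Q: "1 \<notin> Q"
    and V_or_inverse_V: "\<And>x. x \<in> V \<or> inverse x \<in> V"
    and inverse_V: "\<And>x. x \<in> V \<Longrightarrow> x \<notin> Q \<Longrightarrow> inverse x \<in> V"

text \<open>Zorn's lemma is applied to these sets subject to \<open>1\<close> not being a member. A
  maximal one is already the maximal ideal of a valuation ring, so ring and ideal need not be
  enlarged together as a pair.\<close>

definition nonunital_subring :: "'a::field set \<Rightarrow> bool" where
  "nonunital_subring S \<longleftrightarrow>
     0 \<in> S \<and> (\<forall>x\<in>S. \<forall>y\<in>S. x - y \<in> S) \<and> (\<forall>x\<in>S. \<forall>y\<in>S. x * y \<in> S)"

context
  fixes S :: "'a::field set"
  assumes S: "nonunital_subring S"
begin

lemma nonunital_subring_zero: "0 \<in> S"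
  and nonunital_subring_diff: "\<And>x y. x \<in> S \<Longrightarrow> y \<in> S \<Longrightarrow> x - y \<in> S"
  and nonunital_subring_mult: "\<And>x y. x \<in> S \<Longrightarrow> y \<in> S \<Longrightarrow> x * y \<in> S"
  using S by (auto simp: nonunital_subring_def)

lemma nonunital_subring_add: "x \<in> S \<Longrightarrow> y \<in> S \<Longrightarrow> x + y \<in> S"
  using nonunital_subring_diff[of x "0 - y"] nonunital_subring_diff[of 0 y] nonunital_subring_zero
  by simp

lemma nonunital_subring_sum: "(\<And>i. i \<in> A \<Longrightarrow> f i \<in> S) \<Longrightarrow> sum f A \<in> S"
  by (induction A rule: infinite_finite_induct)
     (auto intro: nonunital_subring_zero nonunital_subring_add)

end

lemma maximal_nonunital_subring_exists:
  fixes S :: "'a::field set"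
  assumes "nonunital_subring S" "1 \<notin> S"
  obtains M where "nonunital_subring M" "1 \<notin> M" "S \<subseteq> M"
    "\<And>X. nonunital_subring X \<Longrightarrow> 1 \<notin> X \<Longrightarrow> M \<subseteq> X \<Longrightarrow> X = M"
proof -
  let ?F = "{X. nonunital_subring X \<and> 1 \<notin> X \<and> S \<subseteq> X}"
  have "\<exists>M\<in>?F. \<forall>X\<in>?F. M \<subseteq> X \<longrightarrow> X = M"
  proof (rule subset_Zorn_nonempty)
    show "?F \<noteq> {}" using assms by blast
    fix C assume C: "C \<noteq> {}" "subset.chain ?F C"
    have mem: "X \<in> ?F" if "X \<in> C" for X
      using C(2) that unfolding subset.chain_def by blast
    have tot: "X \<subseteq> Y \<or> Y \<subseteq> X" if "X \<in> C" "Y \<in> C" for X Y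
      using C(2) that unfolding subset_chain_def by blast
    have two: "\<exists>Z\<in>C. x \<in> Z \<and> y \<in> Z" if "x \<in> \<Union>C" "y \<in> \<Union>C" for x y
      using that tot by (meson UnionE subsetD)
    have "nonunital_subring (\<Union>C)"
      unfolding nonunital_subring_def
    proof (intro conjI ballI)
      show "0 \<in> \<Union>C" using C(1) mem by (auto simp: nonunital_subring_def)
    next
      fix x y assume "x \<in> \<Union>C" "y \<in> \<Union>C"
      then obtain Z where Z: "Z \<in> C" "x \<in> Z" "y \<in> Z" using two by blast
      with mem have "nonunital_subring Z" by blast
      then have "x - y \<in> Z" "x * y \<in> Z" using Z by (auto simp: nonunital_subring_def)
      then show "x - y \<in> \<Union>C" "x * y \<in> \<Union>C" using Z(1) by blast+
    qed
    then show "\<Union>C \<in> ?F" using C(1) mem by blast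
  qed
  then show ?thesis using that by (smt (verit) mem_Collect_eq subset_trans)
qed

text \<open>Chevalley's existence theorem. An \<open>x\<close> outside the idealizer makes
  \<open>1\<close> a polynomial in \<open>x\<close> with coefficients in \<open>Q\<close>; this
  cannot happen for both \<open>x\<close> and its inverse.\<close>

theorem valuation_ring_exists:
  fixes S :: "'a::field set"
  assumes "nonunital_subring S" "1 \<notin> S"
  obtains V Q where "valuation_ring V Q" "S \<subseteq> Q"
proof -
  obtain Q where Q: "nonunital_subring Q" "1 \<notin> Q" "S \<subseteq> Q"
    and max: "\<And>X. nonunital_subring X \<Longrightarrow> 1 \<notin> X \<Longrightarrow> Q \<subseteq> X \<Longrightarrow> X = Q"
    using maximal_nonunital_subring_exists[OF assms] by metis
  note Q0 = nonunital_subring_zero[OF Q(1)] and Qd = nonunital_subring_diff[OF Q(1)]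
    and Qm = nonunital_subring_mult[OF Q(1)] and Qa = nonunital_subring_add[OF Q(1)]
    and Qs = nonunital_subring_sum[OF Q(1)]
  \<comment> \<open>For maximal \<open>Q\<close>, the idealizer of \<open>Q\<close> is the valuation ring.\<close>
  define V where "V = {x. \<forall>q\<in>Q. x * q \<in> Q}"
  have VQ: "x * q \<in> Q" if "x \<in> V" "q \<in> Q" for x q using that by (auto simp: V_def)
  have V1: "1 \<in> V" by (simp add: V_def)
  have Vd: "x - y \<in> V" if "x \<in> V" "y \<in> V" for x y
    using that by (auto simp: V_def left_diff_distrib intro: Qd)
  have Vm: "x * y \<in> V" if "x \<in> V" "y \<in> V" for x y
    using that by (auto simp: V_def mult.assoc)
  have Vp: "x ^ k \<in> V" if "x \<in> V" for x k
    by (induction k) (use that in \<open>auto intro: Vm V1\<close>)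
  have QV: "Q \<subseteq> V" by (auto simp: V_def intro: Qm)

  \<comment> \<open>The values at \<open>x\<close> of polynomials with all coefficients in
    \<open>Q\<close>, constant term included, form a candidate that contains \<open>Q\<close> and
    all \<open>q * x\<close>. If \<open>1\<close> were missing, maximality would give
    \<open>q * x \<in> Q\<close> for all \<open>q\<close>, that is,
    \<open>x \<in> V\<close>.\<close>
  have rep: "\<exists>a n. (\<forall>i. a i \<in> Q) \<and> (\<Sum>i\<le>n. a i * x ^ i) = 1" if "x \<notin> V" for x
  proof (rule ccontr)
    assume no: "\<not> ?thesis"
    let ?X = "{poly f x | f. \<forall>i. coeff f i \<in> Q}"
    have "nonunital_subring ?X"
      unfolding nonunital_subring_def
    proof (intro conjI ballI)
      show "0 \<in> ?X" by (rule CollectI, rule exI[of _ 0]) (simp add: Q0)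
      fix a b assume "a \<in> ?X" "b \<in> ?X"
      then obtain f g where fg: "a = poly f x" "\<forall>i. coeff f i \<in> Q" "b = poly g x" "\<forall>i. coeff g i \<in> Q"
        by blast
      show "a - b \<in> ?X" by (rule CollectI, rule exI[of _ "f - g"]) (simp add: fg Qd)
      show "a * b \<in> ?X"
        by (rule CollectI, rule exI[of _ "f * g"]) (simp add: fg coeff_mult Qs Qm)
    qed
    moreover have "1 \<notin> ?X"
    proof
      assume "1 \<in> ?X"
      then obtain f where "1 = poly f x" "\<forall>i. coeff f i \<in> Q" by blast
      then show False using no by (auto simp: poly_altdef)
    qed
    moreover have "Q \<subseteq> ?X"
    proof
      fix q assume "q \<in> Q"
      then have "\<forall>i. coeff [:q:] i \<in> Q" using Q0 by (simp add: coeff_pCons split: nat.split)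
      then show "q \<in> ?X" by (intro CollectI exI[of _ "[:q:]"]) simp
    qed
    ultimately have "?X = Q" by (rule max)
    moreover have "q * x \<in> ?X" if "q \<in> Q" for q
    proof -
      have "\<forall>i. coeff [:0, q:] i \<in> Q" using Q0 that by (simp add: coeff_pCons split: nat.split)
      then show ?thesis by (intro CollectI exI[of _ "[:0, q:]"]) (simp add: mult.commute)
    qed
    ultimately show False using \<open>x \<notin> V\<close> by (auto simp: V_def mult.commute)
  qed

  \<comment> \<open>Otherwise \<open>rep\<close> applied to \<open>inverse u\<close>, multiplied by
    \<open>u ^ n\<close>, puts \<open>u ^ n\<close> into \<open>Q\<close>, although
    \<open>u\<close>, and hence \<open>u ^ n\<close>, is congruent to \<open>1\<close>.\<close>
  have unit: "inverse u \<in> V" if "1 - u \<in> Q" for u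
  proof (rule ccontr)
    assume "inverse u \<notin> V"
    then obtain a n where a: "\<forall>i. a i \<in> Q" "(\<Sum>i\<le>n. a i * inverse u ^ i) = 1"
      using rep by blast
    have uV: "u \<in> V" using Vd[OF V1, of "1 - u"] QV that by auto
    have u0: "u \<noteq> 0" using that Q(2) by auto
    have "u ^ n = u ^ n * (\<Sum>i\<le>n. a i * inverse u ^ i)" using a by simp
    also have "\<dots> = (\<Sum>i\<le>n. u ^ (n - i) * a i)"
      unfolding sum_distrib_left
      by (rule sum.cong) (use u0 in \<open>auto simp: power_diff power_inverse divide_simps\<close>)
    also have "\<dots> \<in> Q" using a by (intro Qs VQ Vp uV) auto
    finally have un: "u ^ n \<in> Q" .
    have "1 - u ^ k \<in> Q" for k
    proof (induction k)
      case 0 then show ?case using Q0 by simp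
    next
      case (Suc k)
      have "1 - u ^ Suc k = (1 - u) + u * (1 - u ^ k)" by (simp add: algebra_simps)
      then show ?case using that Suc VQ uV Qa by metis
    qed
    from Qa[OF this[of n] un] Q(2) show False by simp
  qed

  \<comment> \<open>Chevalley: of two such representations, the shorter one lowers the degree of the longer one.\<close>
  have no_two: False if "(\<forall>i. a i \<in> Q)" "(\<Sum>i\<le>n. a i * x ^ i) = 1" "(\<forall>i. b i \<in> Q)"
    "(\<Sum>i\<le>m. b i * inverse x ^ i) = 1" for x a n b m
    using that
  proof (induction "n + m" arbitrary: x a n b m rule: less_induct)
    case less
    \<comment> \<open>The case of the longer representation in \<open>x\<close>, with its own
      variables and the induction hypothesis as an assumption, so that it also serves after
      exchanging \<open>x\<close> with its inverse.\<close>
    have core: False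
      if nm: "m \<le> n" and a: "\<forall>i. a i \<in> Q" "(\<Sum>i\<le>n. a i * x ^ i) = 1"
        and b: "\<forall>i. b i \<in> Q" "(\<Sum>i\<le>m. b i * inverse x ^ i) = 1"
        and IH: "\<And>a'. \<forall>i. a' i \<in> Q \<Longrightarrow> n \<ge> 1 \<Longrightarrow> (\<Sum>i\<le>n - 1. a' i * x ^ i) = 1 \<Longrightarrow> False"
      for x a n b m
    proof -
      have split: "(\<Sum>i\<le>m. b i * inverse x ^ i) = b 0 + (\<Sum>i\<in>{1..m}. b i * inverse x ^ i)"
        by (simp add: atMost_atLeast0 sum.atLeast_Suc_atMost)
      have m: "m \<noteq> 0"
      proof
        assume "m = 0"
        then have "b 0 = 1" using b(2) by simp
        then show False using b(1) Q(2) by metis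
      qed
      have x0: "x \<noteq> 0"
      proof
        assume "x = 0"
        then have "b 0 = 1" using b(2) split by (simp add: sum.neutral)
        then show False using b(1) Q(2) by metis
      qed
      define u where "u = 1 - b 0"
      have uV: "inverse u \<in> V" by (rule unit) (use b(1) in \<open>simp add: u_def\<close>)
      have u0: "u \<noteq> 0" using spec[OF b(1), of 0] Q(2) by (auto simp: u_def)
      have "u = (\<Sum>i\<in>{1..m}. b i * inverse x ^ i)"
        using b(2) split by (simp add: u_def algebra_simps)
      then have "1 = inverse u * (\<Sum>i\<in>{1..m}. b i * inverse x ^ i)" using u0 by simp
      \<comment> \<open>Multiplying the top term by this expression for \<open>1\<close>, which has
        only negative powers of \<open>x\<close>, turns it into terms with exponents from
        \<open>n - m\<close> to \<open>n - 1\<close>.\<close>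
      then have "a n * x ^ n = a n * x ^ n * (inverse u * (\<Sum>i\<in>{1..m}. b i * inverse x ^ i))"
        by simp
      also have "\<dots> = (\<Sum>i\<in>{1..m}. a n * inverse u * b i * x ^ (n - i))"
        unfolding sum_distrib_left
        by (rule sum.cong) (use x0 nm in \<open>auto simp: power_diff power_inverse divide_simps\<close>)
      also have "\<dots> = (\<Sum>i\<in>{n - m..n - 1}. a n * inverse u * b (n - i) * x ^ i)"
        by (rule sum.reindex_bij_witness[of _ "\<lambda>i. n - i" "\<lambda>i. n - i"]) (use nm m in auto)
      also have "\<dots> = (\<Sum>i\<le>n - 1. (if n - m \<le> i then a n * inverse u * b (n - i) else 0) * x ^ i)"
        by (rule sum.mono_neutral_cong_left) auto
      finally have an: "a n * x ^ n = \<dots>" .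
      define a' where "a' i = a i + (if n - m \<le> i then a n * inverse u * b (n - i) else 0)" for i
      have top: "(\<Sum>i\<le>n. a i * x ^ i) = (\<Sum>i\<le>n - 1. a i * x ^ i) + a n * x ^ n"
        using nm m by (cases n) auto
      have "(\<Sum>i\<le>n - 1. a' i * x ^ i) = (\<Sum>i\<le>n - 1. a i * x ^ i) +
          (\<Sum>i\<le>n - 1. (if n - m \<le> i then a n * inverse u * b (n - i) else 0) * x ^ i)"
        unfolding a'_def distrib_right sum.distrib ..
      then have "(\<Sum>i\<le>n - 1. a' i * x ^ i) = 1"
        using a(2) an top by metis
      moreover have "a n * inverse u * b (n - i) \<in> Q" for i
        using VQ[OF uV, of "a n"] a b Qm by (simp add: mult.commute)
      then have "\<forall>i. a' i \<in> Q"
        using a Q0 by (auto simp: a'_def intro!: Qa)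
      ultimately show False using IH nm m by simp
    qed
    show False
    proof (cases "m \<le> n")
      case True
      show False
        by (rule core[OF True less(2,3,4,5)]) (rule less(1)[of "n - 1" m], use less(4,5) in auto)
    next
      case False
      then have nm: "n \<le> m" by simp
      have inv: "(\<Sum>i\<le>n. a i * inverse (inverse x) ^ i) = 1" using less(3) by simp
      show False
        by (rule core[OF nm less(4,5,2) inv]) (rule less(1)[of n "m - 1" a x], use less(2,3) in auto)
    qed
  qed

  have "valuation_ring V Q"
  proof
    show "x \<in> V \<or> inverse x \<in> V" for x
      using rep[of x] rep[of "inverse x"] no_two by blast
    show "inverse x \<in> V" if x: "x \<in> V" "x \<notin> Q" for x
    proof -
      \<comment> \<open>This set contains \<open>Q\<close> and also \<open>x \<notin> Q\<close>, so
        maximality forces \<open>1\<close> into it. Then \<open>1 - x * v \<in> Q\<close> for some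
        \<open>v \<in> V\<close>, and \<open>unit\<close> inverts \<open>x * v\<close>.\<close>
      let ?X = "{q + x * v | q v. q \<in> Q \<and> v \<in> V}"
      have "nonunital_subring ?X"
        unfolding nonunital_subring_def
      proof (intro conjI ballI)
        have "0 \<in> V" using V1 Vd by force
        then show "0 \<in> ?X" using Q0 by force
        fix a b assume "a \<in> ?X" "b \<in> ?X"
        then obtain q v q' v' where ab: "a = q + x * v" "b = q' + x * v'" "q \<in> Q" "q' \<in> Q" "v \<in> V" "v' \<in> V"
          by blast
        have "a - b = (q - q') + x * (v - v')" by (simp add: ab algebra_simps)
        then show "a - b \<in> ?X" using Qd Vd ab by blast
        have "a * b = (b * q + x * v * q') + x * (x * v * v')"
          by (simp add: ab algebra_simps)
        moreover have "b \<in> V"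
        proof -
          have "q' - (0 - x * v') \<in> V" using ab x QV \<open>0 \<in> V\<close> by (intro Vd Vm) auto
          then show ?thesis by (simp add: ab)
        qed
        then have "b * q + x * v * q' \<in> Q" "x * v * v' \<in> V"
          using ab x by (auto intro!: Qa VQ Vm)
        ultimately show "a * b \<in> ?X" by blast
      qed
      moreover have "Q \<subseteq> ?X"
      proof
        fix q assume "q \<in> Q"
        moreover have "0 \<in> V" using V1 Vd by force
        ultimately show "q \<in> ?X" by force
      qed
      moreover have "x \<in> ?X" using Q0 V1 by force
      ultimately have "1 \<in> ?X" using max[of ?X] x by blast
      then obtain q v where qv: "1 = q + x * v" "q \<in> Q" "v \<in> V" by blast
      then have "1 - x * v = q" by (metis add_diff_cancel_right')
      then have "inverse (x * v) \<in> V" using unit qv(2) by blast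
      then have "v * inverse (x * v) \<in> V" using qv Vm by blast
      moreover have "v * inverse (x * v) = inverse x"
      proof -
        have "x * v \<noteq> 0" using qv Q(2) by auto
        then show ?thesis by (simp add: field_simps)
      qed
      ultimately show ?thesis by metis
    qed
  qed (use V1 Vd Vm QV Q0 Qd VQ Q(2) in auto)
  then show ?thesis using that Q(3) by blast
qed

context valuation_ring
begin

lemma zero_V: "0 \<in> V"
  using minus_V[OF one_V one_V] by simp

lemma add_V: "x \<in> V \<Longrightarrow> y \<in> V \<Longrightarrow> x + y \<in> V"
  using minus_V[of x "0 - y"] minus_V[of 0 y] zero_V by simp

lemma sum_V: "(\<And>i. i \<in> A \<Longrightarrow> f i \<in> V) \<Longrightarrow> sum f A \<in> V"
  by (induction A rule: infinite_finite_induct) (auto intro: zero_V add_V)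

lemma prod_V: "(\<And>i. i \<in> A \<Longrightarrow> f i \<in> V) \<Longrightarrow> prod f A \<in> V"
  by (induction A rule: infinite_finite_induct) (auto intro: one_V times_V)

lemma power_V: "x \<in> V \<Longrightarrow> x ^ k \<in> V"
  by (induction k) (auto intro: one_V times_V)

lemma of_nat_V: "of_nat n \<in> V"
  by (induction n) (auto intro: zero_V add_V one_V)

lemma of_int_V: "of_int k \<in> V"
  by (cases k rule: int_diff_cases) (auto intro: minus_V of_nat_V)

lemma Q_V: "x \<in> Q \<Longrightarrow> x \<in> V"
  using Q_subset_V by blast

lemma add_Q: "x \<in> Q \<Longrightarrow> y \<in> Q \<Longrightarrow> x + y \<in> Q"
  using minus_Q[of x "0 - y"] minus_Q[of 0 y] zero_Q by simp

lemma minus_iff_Q: "x - y \<in> Q \<Longrightarrow> x \<in> Q \<longleftrightarrow> y \<in> Q"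
  using add_Q[of "x - y" y] minus_Q[of x "x - y"] by auto

lemma times_Q_V: "x \<in> Q \<Longrightarrow> y \<in> V \<Longrightarrow> x * y \<in> Q"
  using times_V_Q[of y x] by (simp add: mult.commute)

lemma sum_Q: "(\<And>i. i \<in> A \<Longrightarrow> f i \<in> Q) \<Longrightarrow> sum f A \<in> Q"
  by (induction A rule: infinite_finite_induct) (auto intro: zero_Q add_Q)

lemma prime_Q:
  assumes "x \<in> V" "y \<in> V" "x * y \<in> Q"
  shows "x \<in> Q \<or> y \<in> Q"
proof (rule ccontr)
  assume neg: "\<not> ?thesis"
  have "inverse x * (x * y) \<in> Q"
    using assms neg by (intro times_V_Q[OF inverse_V]) auto
  moreover have "x \<noteq> 0" using neg zero_Q by auto
  then have "inverse x * (x * y) = y" by simp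
  ultimately show False using neg by simp
qed

lemma power_in_Q_imp: "x \<in> V \<Longrightarrow> x ^ k \<in> Q \<Longrightarrow> x \<in> Q"
proof (induction k)
  case 0
  then show ?case using one_notin_Q by simp
next
  case (Suc k)
  then show ?case using prime_Q[of x "x ^ k"] power_V by auto
qed

lemma power_Q: "x \<in> Q \<Longrightarrow> k > 0 \<Longrightarrow> x ^ k \<in> Q"
  by (cases k) (auto intro: times_Q_V power_V Q_V)

lemma prod_notin_Q:
  "(\<And>i. i \<in> A \<Longrightarrow> f i \<in> V - Q) \<Longrightarrow> prod f A \<notin> Q"
proof (induction A rule: infinite_finite_induct)
  case (insert a A)
  then have "f a \<in> V" "f a \<notin> Q" "prod f A \<in> V" "prod f A \<notin> Q"
    by (auto intro!: prod_V)
  then show ?case using insert.hyps prime_Q by auto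
qed (use one_notin_Q in auto)

lemma power_diff_one_Q: "x \<in> V \<Longrightarrow> x - 1 \<in> Q \<Longrightarrow> x ^ k - 1 \<in> Q"
proof (induction k)
  case (Suc k)
  have "x ^ Suc k - 1 = x * (x ^ k - 1) + (x - 1)" by (simp add: algebra_simps)
  then show ?case using Suc add_Q times_V_Q by metis
qed (simp add: zero_Q)

text \<open>If \<open>x\<close> is not in \<open>V\<close>, its inverse is, and \<open>x\<close> is
  a power of that inverse.\<close>

lemma root_of_unity_V:
  assumes "x ^ n = 1" "n > 0"
  shows "x \<in> V"
proof -
  have "x * x ^ (n - 1) = 1" using assms by (cases n) auto
  then have x: "x = inverse x ^ (n - 1)"
    by (metis inverse_inverse_eq inverse_unique mult.commute power_inverse)
  show ?thesis using V_or_inverse_V[of x] power_V x by metis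
qed

text \<open>Amounts to dividing by an entry of least valuation. In the induction, a new entry whose
  scaled value falls outside \<open>V\<close> becomes the new divisor.\<close>

lemma scale_into_V:
  assumes "finite A" "\<exists>i\<in>A. c i \<noteq> 0"
  obtains d where "\<forall>i\<in>A. d * c i \<in> V" "\<exists>i\<in>A. d * c i = 1"
proof -
  have "\<exists>d. (\<forall>i\<in>A. d * c i \<in> V) \<and> (\<exists>i\<in>A. d * c i = 1)"
    using assms
  proof (induction A rule: finite_induct)
    case (insert a A)
    show ?case
    proof (cases "\<exists>i\<in>A. c i \<noteq> 0")
      case False
      then show ?thesis
        using insert.prems by (intro exI[of _ "inverse (c a)"]) (auto simp: zero_V one_V)
    next
      case True
      then obtain d where d: "\<forall>i\<in>A. d * c i \<in> V" "\<exists>i\<in>A. d * c i = 1"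
        using insert.IH by blast
      show ?thesis
      proof (cases "d * c a \<in> V")
        case True
        then show ?thesis using d by blast
      next
        case False
        then have inv: "inverse (d * c a) \<in> V" using V_or_inverse_V by blast
        have nz: "d * c a \<noteq> 0" using False zero_V by metis
        let ?d = "inverse (d * c a) * d"
        have "?d * c a = 1" using left_inverse[OF nz] by (simp add: mult.assoc)
        moreover have "?d * c i \<in> V" if "i \<in> A" for i
          using times_V[OF inv] d that by (simp add: mult.assoc)
        ultimately show ?thesis using one_V by (intro exI[of _ ?d]) auto
      qed
    qed
  qed auto
  then show ?thesis using that by blast
qed

end

section \<open>Residue characteristic \<open>p\<close>: Frobenius and roots of unity modulo
  \<open>Q\<close>\<close>

locale residue_char_valuation_ring = valuation_ring V Q for V Q :: "'a::field_char_0 set" +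
  fixes p :: nat
  assumes prime_p: "prime p" and p_Q: "of_nat p \<in> Q"
begin

lemma of_int_Q_iff: "of_int k \<in> Q \<longleftrightarrow> int p dvd k"
proof
  assume "int p dvd k"
  then obtain m where "k = int p * m" by blast
  then show "of_int k \<in> Q" using p_Q of_int_V by (auto intro: times_Q_V)
next
  assume k: "of_int k \<in> Q"
  show "int p dvd k"
  proof (rule ccontr)
    assume "\<not> int p dvd k"
    then have "coprime (int p) k" using prime_p prime_imp_coprime[of "int p" k] by simp
    then obtain a b where "a * int p + b * k = 1"
      by (metis bezout_int coprime_iff_gcd_eq_1)
    then have "of_int (a * int p + b * k) = (1 :: 'a)" by simp
    then have "of_int a * of_nat p + of_int b * of_int k = (1 :: 'a)" by simp
    moreover have "of_int a * of_nat p + of_int b * of_int k \<in> Q"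
      using k p_Q of_int_V by (intro add_Q times_V_Q) auto
    ultimately show False using one_notin_Q by simp
  qed
qed

lemma of_nat_Q_iff: "of_nat k \<in> Q \<longleftrightarrow> p dvd k"
  using of_int_Q_iff[of "int k"] by simp

lemma frobenius_add:
  assumes "x \<in> V" "y \<in> V"
  shows "(x + y) ^ p - (x ^ p + y ^ p) \<in> Q"
proof -
  let ?f = "\<lambda>k. of_nat (p choose k) * x ^ k * y ^ (p - k)"
  have p: "p > 1" using prime_p prime_gt_1_nat by blast
  have "{..p} = {0, p} \<union> {1..<p}" using p by auto
  then have "(x + y) ^ p = (\<Sum>k\<in>{0, p} \<union> {1..<p}. ?f k)"
    by (simp add: binomial_ring)
  also have "\<dots> = (x ^ p + y ^ p) + (\<Sum>k=1..<p. ?f k)"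
    using p by (subst sum.union_disjoint) auto
  finally have "(x + y) ^ p - (x ^ p + y ^ p) = (\<Sum>k=1..<p. ?f k)" by simp
  also have "\<dots> \<in> Q"
  proof (intro sum_Q times_Q_V power_V assms)
    fix k assume "k \<in> {1..<p}"
    then have "p dvd (p choose k)" using prime_p by (intro dvd_choose_prime) auto
    then show "of_nat (p choose k) \<in> Q" by (simp add: of_nat_Q_iff)
  qed
  finally show ?thesis .
qed

lemma frobenius_of_int: "of_int a ^ p - of_int a \<in> Q"
proof (induction a rule: int_induct[where k = 0])
  case base
  then show ?case using zero_Q prime_gt_0_nat[OF prime_p] by (simp add: power_0_left)
next
  case (step1 i)
  have "of_int (i + 1) ^ p - of_int (i + 1) =
      ((of_int i + 1) ^ p - (of_int i ^ p + 1 ^ p)) + (of_int i ^ p - (of_int i :: 'a))" by simp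
  then show ?case using step1 add_Q frobenius_add[OF of_int_V one_V] by metis
next
  case (step2 i)
  let ?j = "of_int (i - 1) :: 'a"
  have "?j ^ p - ?j = (of_int i ^ p - of_int i) - ((?j + 1) ^ p - (?j ^ p + 1 ^ p))" by simp
  then show ?case using step2 minus_Q frobenius_add[OF of_int_V one_V] by metis
qed

lemma poly_of_int_poly_V: "x \<in> V \<Longrightarrow> poly (map_poly of_int h) x \<in> V"
  by (auto simp: poly_altdef coeff_map_poly intro!: sum_V times_V of_int_V power_V)

text \<open>Frobenius fixes the integer coefficients modulo \<open>Q\<close>, so only the point is
  raised to the power \<open>p\<close>. This carries a zero modulo \<open>Q\<close> from
  \<open>x\<close> to \<open>x ^ p\<close>.\<close>

lemma frobenius_poly:
  assumes x: "x \<in> V"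
  shows "poly (map_poly of_int h) x ^ p - poly (map_poly of_int h) (x ^ p) \<in> Q"
proof (induction h)
  case 0
  then show ?case using zero_Q prime_gt_0_nat[OF prime_p] by (simp add: power_0_left)
next
  case (pCons a h)
  let ?h = "\<lambda>x. poly (map_poly of_int h) x :: 'a"
  have "poly (map_poly of_int (pCons a h)) x ^ p - poly (map_poly of_int (pCons a h)) (x ^ p) =
    ((of_int a + x * ?h x) ^ p - (of_int a ^ p + (x * ?h x) ^ p)) + (of_int a ^ p - of_int a)
      + x ^ p * (?h x ^ p - ?h (x ^ p))"
    by (simp add: map_poly_pCons power_mult_distrib algebra_simps)
  also have "\<dots> \<in> Q"
    by (intro add_Q times_V_Q frobenius_add frobenius_of_int power_V x of_int_V times_V
        poly_of_int_poly_V pCons)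
  finally show ?case .
qed

text \<open>By Frobenius \<open>(x - 1) ^ p\<close> is congruent to \<open>x ^ p - 1 = 0\<close>,
  and \<open>Q\<close> is prime.\<close>

lemma p_power_root_of_unity:
  assumes "x ^ p = 1"
  shows "x - 1 \<in> Q"
proof -
  have "x \<in> V" using assms root_of_unity_V prime_gt_0_nat[OF prime_p] by blast
  then have x1: "x - 1 \<in> V" using minus_V one_V by blast
  have "(x - 1) ^ p = 0 - (((x - 1) + 1) ^ p - ((x - 1) ^ p + 1 ^ p))" using assms by simp
  also have "\<dots> \<in> Q" by (intro minus_Q zero_Q frobenius_add x1 one_V)
  finally show ?thesis using power_in_Q_imp x1 by blast
qed

text \<open>The geometric sum of the powers of \<open>x\<close> vanishes, but for \<open>x\<close>
  congruent to \<open>1\<close> it would be congruent to \<open>r\<close>, which \<open>p\<close>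
  does not divide.\<close>

lemma nontrivial_root_of_unity_not_cong_1:
  assumes "prime r" "r \<noteq> p" "x ^ r = 1" "x \<noteq> 1"
  shows "x - 1 \<notin> Q"
proof
  assume Q: "x - 1 \<in> Q"
  have xV: "x \<in> V" using assms root_of_unity_V prime_gt_0_nat by blast
  have "(x - 1) * (\<Sum>i<r. x ^ i) = 0"
    using assms by (simp add: power_diff_1_eq[symmetric])
  then have 0: "(\<Sum>i<r. x ^ i) = 0" using assms by simp
  have "of_nat r = (\<Sum>i<r. x ^ i) - (\<Sum>i<r. x ^ i - 1)"
    by (simp add: sum_subtractf)
  also have "\<dots> \<in> Q" unfolding 0
    by (rule minus_Q[OF zero_Q sum_Q]) (rule power_diff_one_Q[OF xV Q])
  finally have "p dvd r" by (simp add: of_nat_Q_iff)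
  then show False using primes_dvd_imp_eq[OF prime_p assms(1)] assms(2) by simp
qed

end

lemma prime_root_of_unity_power_eq_1_iff:
  fixes x :: "'a::field"
  assumes "prime r" "x ^ r = 1" "x \<noteq> 1"
  shows "x ^ m = 1 \<longleftrightarrow> r dvd m"
proof
  assume "r dvd m"
  then show "x ^ m = 1" using assms by (auto simp: power_mult)
next
  assume m: "x ^ m = 1"
  show "r dvd m"
  proof (rule ccontr)
    assume "\<not> r dvd m"
    then have "coprime m r" using assms(1) prime_imp_coprime by (metis coprime_commute)
    moreover have "m \<noteq> 0" using \<open>\<not> r dvd m\<close> by (metis dvd_0_right)
    ultimately obtain u v where "m * u = r * v + 1"
      using bezout_nat[of m r] by (auto simp: coprime_iff_gcd_eq_1)
    then have "x ^ (m * u) = x ^ (r * v) * x" by simp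
    then show False using assms m by (simp add: power_mult)
  qed
qed

lemma poly_map_of_int_altdef:
  "poly (map_poly of_int h) (x :: 'a::field_char_0) = (\<Sum>e\<le>degree h. of_int (coeff h e) * x ^ e)"
  by (simp add: poly_altdef degree_map_poly coeff_map_poly)

lemma sum_powers_root_of_unity:
  fixes x :: "'a::field"
  assumes "x ^ r = 1"
  shows "(\<Sum>i<r. x ^ i) = (if x = 1 then of_nat r else 0)"
proof -
  have "(x - 1) * (\<Sum>i<r. x ^ i) = 0"
    using assms by (simp add: power_diff_1_eq[symmetric])
  then show ?thesis by auto
qed

context residue_char_valuation_ring
begin

text \<open>The coefficients are collected into sums \<open>s t\<close> over exponents congruent to
  \<open>t\<close> modulo \<open>r\<close>. Nonnegativity and \<open>N < p\<close> confine these
  sums to an interval shorter than \<open>p\<close>, where congruence modulo \<open>p\<close> is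
  equality.\<close>

lemma nonneg_poly_at_root_of_unity_notin_Q:
  assumes r: "prime r" "r \<noteq> p" "residue_primroot r p"
    and x: "x ^ r = 1" "x \<noteq> 1"
    and h: "\<And>i. coeff h i \<ge> 0" "poly h 1 = int N" "N < p" "\<not> r dvd N"
  shows "poly (map_poly of_int h) x \<notin> Q"
proof
  define H where "H y = poly (map_poly of_int h) y" for y :: 'a
  assume "poly (map_poly of_int h) x \<in> Q"
  then have Hx: "H x \<in> Q" by (simp add: H_def)
  have r1: "r > 1" using r(1) prime_gt_1_nat by blast
  have xV: "x \<in> V" using root_of_unity_V x(1) r1 by simp
  have frob: "H (x ^ (p ^ e)) \<in> Q" for e
  proof (induction e)
    case (Suc e)
    have "H (x ^ (p ^ e)) ^ p \<in> Q"
      using Suc prime_gt_0_nat[OF prime_p] power_Q by blast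
    moreover have "H (x ^ (p ^ e)) ^ p - H ((x ^ (p ^ e)) ^ p) \<in> Q"
      unfolding H_def by (intro frobenius_poly power_V xV)
    ultimately have "H ((x ^ (p ^ e)) ^ p) \<in> Q" using minus_iff_Q by blast
    then show ?case by (simp add: power_mult[symmetric] mult.commute)
  qed (use Hx in simp)
  have x_mod: "x ^ (m mod r) = x ^ m" for m
    using mult_div_mod_eq[of r m] x(1) power_add[of x "r * (m div r)" "m mod r"]
    by (simp add: power_mult)
  have conj: "H (x ^ i) \<in> Q" if "i \<in> {1..<r}" for i
  proof -
    have "i \<in> totatives r"
      using that r(1) by (auto simp: totatives_prime)
    then obtain e where "i = p ^ e mod r"
      using residue_primroot_is_generator[OF r1 r(3)] by (auto simp: bij_betw_def)
    then show ?thesis using frob[of e] x_mod by simp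
  qed
  define s where "s t = (\<Sum>e | e \<le> degree h \<and> e mod r = t. coeff h e)" for t
  have fin: "finite {e. e \<le> degree h \<and> P e}" for P by simp
  have tot: "(\<Sum>t<r. s t) = int N"
  proof -
    have "(\<lambda>e. e mod r) ` {..degree h} \<subseteq> {..<r}" using r1 by (auto intro: mod_less_divisor)
    then have "(\<Sum>t<r. s t) = (\<Sum>e\<le>degree h. coeff h e)"
      using sum.group[of "{..degree h}" "{..<r}" "\<lambda>e. e mod r" "coeff h"] by (simp add: s_def)
    then show ?thesis using h(2) by (simp add: poly_altdef)
  qed
  have s0: "s t \<ge> 0" for t unfolding s_def by (intro sum_nonneg h)
  have sN: "s t \<le> int N" if "t < r" for t
    unfolding tot[symmetric] using that s0 by (intro member_le_sum) auto
  \<comment> \<open>Fourier inversion: \<open>(x ^ i) ^ (r - t)\<close> stands for the power of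
    \<open>x\<close> with exponent \<open>- (i * t)\<close>, so summing over \<open>i\<close>
    isolates the class \<open>t\<close>, scaled by \<open>r\<close>.\<close>
  have dft: "(\<Sum>i<r. (x ^ i) ^ (r - t) * H (x ^ i)) = of_int (int r * s t)" if t: "t < r" for t
  proof -
    have "(\<Sum>i<r. (x ^ i) ^ (r - t) * H (x ^ i)) =
        (\<Sum>i<r. \<Sum>e\<le>degree h. of_int (coeff h e) * (x ^ (e + (r - t))) ^ i)"
      unfolding H_def poly_map_of_int_altdef sum_distrib_left
      by (intro sum.cong refl) (simp add: power_add power_mult[symmetric] algebra_simps)
    also have "\<dots> = (\<Sum>e\<le>degree h. of_int (coeff h e) * (\<Sum>i<r. (x ^ (e + (r - t))) ^ i))"
      by (subst sum.swap) (simp add: sum_distrib_left)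
    also have "\<dots> = (\<Sum>e\<le>degree h. if e mod r = t then of_int (int r * coeff h e) else 0)"
    proof (intro sum.cong refl)
      fix e
      have "(x ^ (e + (r - t))) ^ r = 1"
        using x(1) by (metis mult.commute power_mult power_one)
      moreover have "x ^ (e + (r - t)) = 1 \<longleftrightarrow> e mod r = t"
      proof -
        have "x ^ (e + (r - t)) = 1 \<longleftrightarrow> r dvd e + (r - t)"
          using prime_root_of_unity_power_eq_1_iff[OF r(1) x] .
        also have "\<dots> \<longleftrightarrow> [e + (r - t) = t + (r - t)] (mod r)"
          using t by (auto simp: cong_def)
        also have "\<dots> \<longleftrightarrow> e mod r = t"
          using t by (simp only: cong_add_rcancel_nat) (simp add: cong_def)
        finally show ?thesis .
      qed
      ultimately have "(\<Sum>i<r. (x ^ (e + (r - t))) ^ i) = (if e mod r = t then of_nat r else 0)"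
        using sum_powers_root_of_unity[of "x ^ (e + (r - t))" r] by simp
      then show "of_int (coeff h e) * (\<Sum>i<r. (x ^ (e + (r - t))) ^ i) =
          (if e mod r = t then of_int (int r * coeff h e) else 0)"
        by (simp add: mult.commute)
    qed
    also have "\<dots> = of_int (int r * s t)"
      by (subst sum.inter_filter[symmetric]) (simp_all add: s_def sum_distrib_left)
    finally show ?thesis .
  qed
  \<comment> \<open>Modulo \<open>Q\<close> only the term \<open>i = 0\<close> of the inversion
    formula survives, and it equals \<open>H 1 = N\<close>.\<close>
  have cong: "int p dvd int r * s t - int N" if t: "t < r" for t
  proof -
    have "(\<Sum>i<r. (x ^ i) ^ (r - t) * H (x ^ i)) =
        H 1 + (\<Sum>i\<in>{1..<r}. (x ^ i) ^ (r - t) * H (x ^ i))"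
      using r1 by (simp add: lessThan_atLeast0 sum.atLeast_Suc_lessThan)
    moreover have "(\<Sum>i\<in>{1..<r}. (x ^ i) ^ (r - t) * H (x ^ i)) \<in> Q"
      by (intro sum_Q times_V_Q power_V xV conj)
    moreover have "H 1 = of_int (int N)"
      unfolding H_def poly_map_of_int_altdef h(2)[symmetric] by (simp add: poly_altdef)
    ultimately have "of_int (int r * s t - int N) \<in> Q"
      unfolding dft[OF t] by simp
    then show ?thesis by (simp only: of_int_Q_iff)
  qed
  have eq: "s t = s 0" if t: "t < r" for t
  proof -
    have "int p dvd (int r * s t - int N) - (int r * s 0 - int N)"
      by (intro dvd_diff cong t) (use r1 in simp)
    then have "int p dvd int r * (s t - s 0)" by (simp add: algebra_simps)
    moreover have "coprime (int p) (int r)"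
      using r(1,2) prime_p by (simp add: primes_coprime)
    ultimately have "int p dvd s t - s 0" by (simp add: coprime_dvd_mult_right_iff)
    then have "s t \<noteq> s 0 \<Longrightarrow> \<bar>int p\<bar> \<le> \<bar>s t - s 0\<bar>" by (intro dvd_imp_le_int) auto
    moreover have "\<bar>s t - s 0\<bar> < int p"
      using s0[of t] s0[of 0] sN[OF t] sN[of 0] h(3) r1 by linarith
    ultimately show ?thesis by linarith
  qed
  have "(\<Sum>t<r. s t) = (\<Sum>t<r. s 0)" by (intro sum.cong refl eq) simp
  then have "int N = int r * s 0" unfolding tot by simp
  then have "int r dvd int N" by simp
  then show False using h(4) by simp
qed

end

section \<open>Alternants\<close>

text \<open>A Vandermonde determinant with general exponents. Divided by
  \<open>pair_diff_prod n y\<close> it is, for strictly increasing \<open>a\<close>, a Schur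
  polynomial in \<open>y\<close>.\<close>

definition alternant :: "nat \<Rightarrow> (nat \<Rightarrow> nat) \<Rightarrow> (nat \<Rightarrow> 'a::comm_ring_1) \<Rightarrow> 'a" where
  "alternant n a y = det (mat n n (\<lambda>(i, j). y j ^ a i))"

definition pair_diff_prod :: "nat \<Rightarrow> (nat \<Rightarrow> 'a::comm_ring_1) \<Rightarrow> 'a" where
  "pair_diff_prod n y = (\<Prod>j<n. \<Prod>i<j. y j - y i)"

lemma pair_diff_prod_Suc:
  "pair_diff_prod (Suc n) y = (\<Prod>j<n. y (Suc j) - y 0) * pair_diff_prod n (\<lambda>j. y (Suc j))"
  unfolding pair_diff_prod_def
  by (simp add: prod.lessThan_Suc_shift prod.distrib del: prod.lessThan_Suc)

lemma alternant_cong: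
  "(\<And>i. i < n \<Longrightarrow> a i = b i) \<Longrightarrow> (\<And>i. i < n \<Longrightarrow> y i = z i) \<Longrightarrow> alternant n a y = alternant n b z"
  unfolding alternant_def by (rule arg_cong[of _ _ det]) (auto intro: eq_matI)

text \<open>Multilinearity in the rows once the column factors \<open>c j\<close> are pulled out: a
  choice function \<open>g\<close> selects one exponent from each row.\<close>

lemma det_scaled_power_sums:
  fixes y c :: "nat \<Rightarrow> 'a::comm_ring_1"
  assumes fin: "\<And>i. i < n \<Longrightarrow> finite (B i)"
  shows "det (mat n n (\<lambda>(i, j). c j * (\<Sum>b\<in>B i. w i b * y j ^ b))) =
    (\<Prod>j<n. c j) * (\<Sum>g\<in>PiE {..<n} B. (\<Prod>i<n. w i (g i)) * alternant n g y)"
proof -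
  let ?P = "{\<pi>. \<pi> permutes {0..<n}}"
  have "det (mat n n (\<lambda>(i, j). c j * (\<Sum>b\<in>B i. w i b * y j ^ b))) =
      (\<Sum>\<pi>\<in>?P. signof \<pi> * (\<Prod>i<n. c (\<pi> i) * (\<Sum>b\<in>B i. w i b * y (\<pi> i) ^ b)))"
    by (subst det_def'[of _ n])
       (auto intro!: sum.cong prod.cong simp: permutes_in_image lessThan_atLeast0)
  also have "\<dots> = (\<Sum>\<pi>\<in>?P. \<Sum>g\<in>PiE {..<n} B. (\<Prod>j<n. c j) * (\<Prod>i<n. w i (g i)) *
      (signof \<pi> * (\<Prod>i<n. y (\<pi> i) ^ g i)))"
  proof (rule sum.cong[OF refl])
    fix \<pi> assume "\<pi> \<in> ?P"
    then have perm: "\<pi> permutes {..<n}" by (simp add: lessThan_atLeast0)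
    have "(\<Prod>i<n. c (\<pi> i)) = (\<Prod>j<n. c j)"
      using prod.permute[OF perm, of c] by (simp add: o_def)
    moreover have "(\<Prod>i<n. \<Sum>b\<in>B i. w i b * y (\<pi> i) ^ b) =
        (\<Sum>g\<in>PiE {..<n} B. \<Prod>i<n. w i (g i) * y (\<pi> i) ^ g i)"
      by (rule prod_sum_PiE) (auto intro: fin)
    ultimately show "signof \<pi> * (\<Prod>i<n. c (\<pi> i) * (\<Sum>b\<in>B i. w i b * y (\<pi> i) ^ b)) =
        (\<Sum>g\<in>PiE {..<n} B. (\<Prod>j<n. c j) * (\<Prod>i<n. w i (g i)) *
          (signof \<pi> * (\<Prod>i<n. y (\<pi> i) ^ g i)))"
      by (simp add: prod.distrib sum_distrib_left[symmetric] mult_ac)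
  qed
  also have "\<dots> = (\<Sum>g\<in>PiE {..<n} B. (\<Prod>j<n. c j) * (\<Prod>i<n. w i (g i)) *
      (\<Sum>\<pi>\<in>?P. signof \<pi> * (\<Prod>i<n. y (\<pi> i) ^ g i)))"
    by (subst sum.swap) (simp add: sum_distrib_left)
  also have "\<dots> = (\<Sum>g\<in>PiE {..<n} B. (\<Prod>j<n. c j) * (\<Prod>i<n. w i (g i)) * alternant n g y)"
  proof (rule sum.cong[OF refl])
    fix g
    have "alternant n g y = (\<Sum>\<pi>\<in>?P. signof \<pi> * (\<Prod>i<n. y (\<pi> i) ^ g i))"
      unfolding alternant_def
      by (subst det_def'[of _ n])
         (auto intro!: sum.cong prod.cong simp: permutes_in_image lessThan_atLeast0)
    then show "(\<Prod>j<n. c j) * (\<Prod>i<n. w i (g i)) * (\<Sum>\<pi>\<in>?P. signof \<pi> * (\<Prod>i<n. y (\<pi> i) ^ g i)) =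
        (\<Prod>j<n. c j) * (\<Prod>i<n. w i (g i)) * alternant n g y" by simp
  qed
  finally show ?thesis by (simp add: sum_distrib_left mult.assoc)
qed

text \<open>
  Subtracting \<open>y 0 ^ (a (Suc i) - a i)\<close> times row \<open>i\<close> from row \<open>Suc i\<close> clears the first column; the
  remaining differences of powers are geometric sums, which gives the branching rule for
  Schur polynomials.
\<close>

lemma alternant_Suc:
  fixes y :: "nat \<Rightarrow> 'a::comm_ring_1"
  assumes a: "\<And>i. i < n \<Longrightarrow> a i < a (Suc i)"
  shows "alternant (Suc n) a y = y 0 ^ a 0 * (\<Prod>j<n. y (Suc j) - y 0) *
    (\<Sum>g\<in>PiE {..<n} (\<lambda>i. {a i..<a (Suc i)}).
      (\<Prod>i<n. y 0 ^ (a (Suc i) - Suc (g i))) * alternant n g (\<lambda>j. y (Suc j)))"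
proof -
  let ?n = "Suc n"
  define M where "M = mat ?n ?n (\<lambda>(i, j). y j ^ a i)"
  \<comment> \<open>Left multiplication by this unitriangular matrix performs all the row operations
    at once, each with the original preceding row.\<close>
  define E where "E = mat ?n ?n (\<lambda>(i, k).
    if i = k then 1 else if i = Suc k then - (y 0 ^ (a i - a k)) else 0)"
  have M: "M \<in> carrier_mat ?n ?n" and E: "E \<in> carrier_mat ?n ?n"
    by (simp_all add: M_def E_def)
  have "det E = prod_list (diag_mat E)"
    by (rule det_lower_triangular[OF _ E]) (simp add: E_def)
  also have "\<dots> = 1"
    by (simp add: prod_list_diag_prod E_def)
  finally have detE: "det E = 1" .
  have EM: "E * M = mat ?n ?n (\<lambda>(i, j). if i = 0 then y j ^ a 0
      else y j ^ a i - y 0 ^ (a i - a (i - 1)) * y j ^ a (i - 1))" (is "_ = ?R")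
  proof (rule eq_matI)
    fix i j assume "i < dim_row ?R" "j < dim_col ?R"
    then have ij: "i < ?n" "j < ?n" by auto
    have "(E * M) $$ (i, j) = (\<Sum>k<?n. E $$ (i, k) * M $$ (k, j))"
      using ij E M by (auto simp: scalar_prod_def lessThan_atLeast0)
    also have "\<dots> = (\<Sum>k<?n. (if k = i then y j ^ a i else 0) +
        (if i \<noteq> 0 \<and> k = i - 1 then - (y 0 ^ (a i - a (i - 1))) * y j ^ a (i - 1) else 0))"
      using ij by (intro sum.cong refl) (auto simp: E_def M_def)
    also have "\<dots> = ?R $$ (i, j)"
      unfolding sum.distrib using ij by (cases i) auto
    finally show "(E * M) $$ (i, j) = ?R $$ (i, j)" .
  qed (use E M in auto)
  have aS: "y 0 ^ a (Suc i) = y 0 ^ (a (Suc i) - a i) * y 0 ^ a i" if "i < n" for i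
    using a[OF that] by (simp add: power_add[symmetric])
  have zero: "?R $$ (i, 0) = 0" if "i < ?n" "i \<noteq> 0" for i
    using that aS[of "i - 1"] by (cases i) auto
  have Rc: "?R \<in> carrier_mat ?n ?n" by simp
  have "det M = det (E * M)" using det_mult[OF E M] detE by simp
  also have "\<dots> = det ?R" by (simp only: EM)
  also have "\<dots> = (\<Sum>i<?n. ?R $$ (i, 0) * cofactor ?R i 0)"
    by (rule laplace_expansion_column[OF Rc]) simp
  also have "\<dots> = (\<Sum>i\<in>{0}. ?R $$ (i, 0) * cofactor ?R i 0)"
    by (rule sum.mono_neutral_right) (use zero in auto)
  also have "\<dots> = y 0 ^ a 0 * det (mat_delete ?R 0 0)"
    by (simp add: cofactor_def)
  also have "mat_delete ?R 0 0 = mat n n (\<lambda>(i, j). (y (Suc j) - y 0) *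
      (\<Sum>b\<in>{a i..<a (Suc i)}. y 0 ^ (a (Suc i) - Suc b) * y (Suc j) ^ b))" (is "_ = ?D")
  proof (rule eq_matI)
    fix i j assume "i < dim_row ?D" "j < dim_col ?D"
    then have ij: "i < n" "j < n" by auto
    let ?d = "a (Suc i) - a i" and ?x = "y (Suc j)"
    have "mat_delete ?R 0 0 $$ (i, j) = ?x ^ a (Suc i) - y 0 ^ ?d * ?x ^ a i"
      using ij by (simp add: mat_delete_def)
    also have "?x ^ a (Suc i) = ?x ^ ?d * ?x ^ a i"
      using a[OF ij(1)] by (simp add: power_add[symmetric])
    also have "?x ^ ?d * ?x ^ a i - y 0 ^ ?d * ?x ^ a i = (?x ^ ?d - y 0 ^ ?d) * ?x ^ a i"
      by (simp add: algebra_simps)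
    also have "\<dots> = (?x - y 0) * (\<Sum>e<?d. y 0 ^ (?d - Suc e) * ?x ^ (a i + e))"
      by (simp add: power_diff_sumr2 sum_distrib_left sum_distrib_right power_add mult_ac)
    also have "(\<Sum>e<?d. y 0 ^ (?d - Suc e) * ?x ^ (a i + e)) =
        (\<Sum>b\<in>{a i..<a (Suc i)}. y 0 ^ (a (Suc i) - Suc b) * ?x ^ b)"
      by (rule sum.reindex_bij_witness[of _ "\<lambda>b. b - a i" "\<lambda>e. a i + e"]) auto
    finally show "mat_delete ?R 0 0 $$ (i, j) = ?D $$ (i, j)" using ij by simp
  qed auto
  also have "det ?D = (\<Prod>j<n. y (Suc j) - y 0) * (\<Sum>g\<in>PiE {..<n} (\<lambda>i. {a i..<a (Suc i)}).
      (\<Prod>i<n. y 0 ^ (a (Suc i) - Suc (g i))) * alternant n g (\<lambda>j. y (Suc j)))"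
    by (rule det_scaled_power_sums) simp
  finally show ?thesis by (simp add: alternant_def M_def mult.assoc)
qed

text \<open>For consecutive exponents every interval in the branching rule is a singleton, so one
  summand remains and the Vandermonde formula follows by induction.\<close>

lemma alternant_id: "alternant n (\<lambda>i. i) y = pair_diff_prod n y"
proof (induction n arbitrary: y)
  case 0
  then show ?case by (simp add: alternant_def pair_diff_prod_def)
next
  case (Suc n)
  let ?g = "restrict (\<lambda>i. i) {..<n}"
  have "PiE {..<n} (\<lambda>i. {i..<Suc i}) = PiE {..<n} (\<lambda>i. {?g i})"
    by (rule PiE_cong) auto
  also have "\<dots> = {?g}" by (rule PiE_singleton) (rule restrict_extensional)
  finally have "PiE {..<n} (\<lambda>i. {i..<Suc i}) = {?g}" .
  moreover have "alternant n ?g (\<lambda>j. y (Suc j)) = pair_diff_prod n (\<lambda>j. y (Suc j))"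
    unfolding Suc.IH[symmetric] by (rule alternant_cong) auto
  ultimately show ?case
    by (subst alternant_Suc) (simp_all add: pair_diff_prod_Suc)
qed

lemma vandermonde_det_eq: "vandermonde_det xs = pair_diff_prod (length xs) ((!) xs)"
proof -
  let ?n = "length xs"
  have "mat ?n ?n (\<lambda>(i, j). xs ! i ^ j) = transpose_mat (mat ?n ?n (\<lambda>(i, j). xs ! j ^ i))"
    by (rule eq_matI) auto
  then have "vandermonde_det xs = alternant ?n (\<lambda>i. i) ((!) xs)"
    unfolding vandermonde_det_def alternant_def by (simp add: det_transpose[of _ ?n])
  then show ?thesis by (simp add: alternant_id)
qed

section \<open>Positivity of Schur polynomials and their value at \<open>1\<close>\<close>

definition nonneg_poly :: "int poly \<Rightarrow> bool" where
  "nonneg_poly f \<longleftrightarrow> (\<forall>i. coeff f i \<ge> 0)"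

lemma nonneg_poly_mult: "nonneg_poly f \<Longrightarrow> nonneg_poly g \<Longrightarrow> nonneg_poly (f * g)"
  by (auto simp: nonneg_poly_def coeff_mult intro!: sum_nonneg)

lemma nonneg_poly_sum: "(\<And>i. i \<in> A \<Longrightarrow> nonneg_poly (f i)) \<Longrightarrow> nonneg_poly (sum f A)"
  by (auto simp: nonneg_poly_def coeff_sum intro!: sum_nonneg)

lemma nonneg_poly_1: "nonneg_poly 1"
  by (simp add: nonneg_poly_def)

lemma nonneg_poly_monom: "nonneg_poly (monom 1 k)"
  by (simp add: nonneg_poly_def)

lemma nonneg_poly_prod: "(\<And>i. i \<in> A \<Longrightarrow> nonneg_poly (f i)) \<Longrightarrow> nonneg_poly (prod f A)"
  by (induction A rule: infinite_finite_induct) (auto intro: nonneg_poly_mult nonneg_poly_1)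

lemma nonneg_poly_power: "nonneg_poly f \<Longrightarrow> nonneg_poly (f ^ k)"
  by (induction k) (auto intro: nonneg_poly_mult nonneg_poly_1)

text \<open>The branching rule builds the cofactor \<open>S\<close> from sums and products only, so
  nonnegativity is inherited. \<open>N\<close> is chosen before \<open>y\<close>, which allows it to
  be evaluated later at a convenient \<open>y\<close>.\<close>

lemma alternant_eq_pair_diff_prod_times_nonneg:
  assumes "\<And>i. Suc i < n \<Longrightarrow> a i < a (Suc i)"
  shows "\<exists>N::nat. \<forall>y::nat \<Rightarrow> int poly. (\<forall>j<n. nonneg_poly (y j) \<and> poly (y j) 1 = 1) \<longrightarrow>
    (\<exists>S. nonneg_poly S \<and> poly S 1 = int N \<and> alternant n a y = pair_diff_prod n y * S)"
  using assms
proof (induction n arbitrary: a)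
  case 0
  have "alternant 0 a y = pair_diff_prod 0 y * 1" for y :: "nat \<Rightarrow> int poly"
    by (simp add: alternant_def pair_diff_prod_def)
  then show ?case using nonneg_poly_1 by (intro exI[of _ 1]) force
next
  case (Suc n)
  let ?B = "PiE {..<n} (\<lambda>i. {a i..<a (Suc i)})"
  have fin: "finite ?B" by (intro finite_PiE) auto
  define good where "good g N \<longleftrightarrow> (\<forall>y::nat \<Rightarrow> int poly. (\<forall>j<n. nonneg_poly (y j) \<and> poly (y j) 1 = 1) \<longrightarrow>
    (\<exists>S. nonneg_poly S \<and> poly S 1 = int N \<and> alternant n g y = pair_diff_prod n y * S))" for g N
  have "\<forall>g\<in>?B. \<exists>N. good g N"
  proof
    fix g assume g: "g \<in> ?B"
    \<comment> \<open>The interval for \<open>Suc i\<close> starts where the one for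
      \<open>i\<close> ends, so the selected exponents increase strictly again.\<close>
    have "g i < g (Suc i)" if "Suc i < n" for i
    proof -
      have "g i \<in> {a i..<a (Suc i)}" "g (Suc i) \<in> {a (Suc i)..<a (Suc (Suc i))}"
        using g that by (auto simp: PiE_iff)
      then show ?thesis by simp
    qed
    then show "\<exists>N. good g N" unfolding good_def by (rule Suc.IH)
  qed
  then obtain N where N: "\<And>g. g \<in> ?B \<Longrightarrow> good g (N g)" by metis
  show ?case
  proof (intro exI[of _ "\<Sum>g\<in>?B. N g"] allI impI)
    fix y :: "nat \<Rightarrow> int poly"
    assume y: "\<forall>j<Suc n. nonneg_poly (y j) \<and> poly (y j) 1 = 1"
    have yS: "\<forall>j<n. nonneg_poly (y (Suc j)) \<and> poly (y (Suc j)) 1 = 1" using y by simp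
    have "\<exists>S. nonneg_poly S \<and> poly S 1 = int (N g) \<and>
        alternant n g (\<lambda>j. y (Suc j)) = pair_diff_prod n (\<lambda>j. y (Suc j)) * S" if "g \<in> ?B" for g
      using spec[OF N[OF that, unfolded good_def], of "\<lambda>j. y (Suc j)"] yS by (rule mp)
    then have "\<exists>S. \<forall>g\<in>?B. nonneg_poly (S g) \<and> poly (S g) 1 = int (N g) \<and>
        alternant n g (\<lambda>j. y (Suc j)) = pair_diff_prod n (\<lambda>j. y (Suc j)) * S g"
      by (intro bchoice ballI)
    then obtain S where S: "\<And>g. g \<in> ?B \<Longrightarrow> nonneg_poly (S g)"
      "\<And>g. g \<in> ?B \<Longrightarrow> poly (S g) 1 = int (N g)"
      "\<And>g. g \<in> ?B \<Longrightarrow> alternant n g (\<lambda>j. y (Suc j)) = pair_diff_prod n (\<lambda>j. y (Suc j)) * S g"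
      by blast
    define T where "T = y 0 ^ a 0 * (\<Sum>g\<in>?B. (\<Prod>i<n. y 0 ^ (a (Suc i) - Suc (g i))) * S g)"
    have "nonneg_poly T"
      unfolding T_def using y S(1)
      by (intro nonneg_poly_mult nonneg_poly_power nonneg_poly_sum nonneg_poly_prod) auto
    moreover have "poly T 1 = int (\<Sum>g\<in>?B. N g)"
      using y S(2) by (simp add: T_def poly_sum poly_prod)
    moreover have "alternant (Suc n) a y = pair_diff_prod (Suc n) y * T"
    proof -
      have "alternant (Suc n) a y = y 0 ^ a 0 * (\<Prod>j<n. y (Suc j) - y 0) *
        (\<Sum>g\<in>?B. (\<Prod>i<n. y 0 ^ (a (Suc i) - Suc (g i))) * (pair_diff_prod n (\<lambda>j. y (Suc j)) * S g))"
        using Suc.prems S(3) by (subst alternant_Suc) auto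
      also have "\<dots> = pair_diff_prod (Suc n) y * T"
        by (simp add: pair_diff_prod_Suc T_def sum_distrib_left mult_ac)
      finally show ?thesis .
    qed
    ultimately show "\<exists>S. nonneg_poly S \<and> poly S 1 = int (\<Sum>g\<in>?B. N g) \<and>
        alternant (Suc n) a y = pair_diff_prod (Suc n) y * S" by blast
  qed
qed

text \<open>Since \<open>N\<close> is the same for all \<open>y\<close>, one specialisation
  identifies it as the quotient of two Vandermonde products.\<close>

lemma alternant_factor:
  assumes a: "\<And>i j. i < j \<Longrightarrow> j < n \<Longrightarrow> a i < a j"
  obtains N :: nat
  where "int N * pair_diff_prod n int = pair_diff_prod n (\<lambda>i. int (a i))"
    and "\<And>y :: nat \<Rightarrow> int poly. (\<And>j. j < n \<Longrightarrow> nonneg_poly (y j) \<and> poly (y j) 1 = 1) \<Longrightarrow>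
      \<exists>S. nonneg_poly S \<and> poly S 1 = int N \<and> alternant n a y = pair_diff_prod n y * S"
proof -
  obtain N where N: "\<And>y :: nat \<Rightarrow> int poly. (\<And>j. j < n \<Longrightarrow> nonneg_poly (y j) \<and> poly (y j) 1 = 1) \<Longrightarrow>
      \<exists>S. nonneg_poly S \<and> poly S 1 = int N \<and> alternant n a y = pair_diff_prod n y * S"
    using alternant_eq_pair_diff_prod_times_nonneg[of n a] a by auto
  let ?X = "\<lambda>k. monom (1::int) k"
  \<comment> \<open>\<open>K\<close> collects one factor \<open>X - 1\<close> for each pair of
    indices; \<open>q k l\<close> is the quotient of \<open>X ^ l - X ^ k\<close> by
    \<open>X - 1\<close>, whose value at \<open>1\<close> is \<open>l - k\<close>.\<close>
  define K where "K = (\<Prod>j<n. \<Prod>i<j. ?X 1 - 1)"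
  define q where "q k l = (\<Sum>e\<in>{k..<l}. ?X e)" for k l
  have diff: "?X l - ?X k = (?X 1 - 1) * q k l" if "k \<le> l" for k l
    using that
  proof (induction l rule: dec_induct)
    case (step l)
    have "q k (Suc l) = q k l + ?X l" using step by (simp add: q_def)
    moreover have "?X (Suc l) = ?X 1 * ?X l" by (simp add: mult_monom)
    then have "?X (Suc l) - ?X k = (?X l - ?X k) + (?X 1 - 1) * ?X l" by (simp add: algebra_simps)
    ultimately show ?case using step.IH by (simp only: distrib_left)
  qed (simp add: q_def)
  have prod_eq: "pair_diff_prod n (\<lambda>j. ?X (b j)) = K * (\<Prod>j<n. \<Prod>i<j. q (b i) (b j))"
    if "\<And>i j. i < j \<Longrightarrow> j < n \<Longrightarrow> b i < b j" for b
    unfolding pair_diff_prod_def K_def prod.distrib[symmetric]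
    by (intro prod.cong refl diff less_imp_le that) auto
  obtain S where S: "poly S 1 = int N" "alternant n a ?X = pair_diff_prod n ?X * S"
    using N[of ?X] by (auto simp: nonneg_poly_monom poly_monom)
  \<comment> \<open>Specialising to \<open>y j = X ^ j\<close> makes the alternant a Vandermonde determinant in the \<open>X ^ a i\<close>.
    Cancelling the powers of \<open>X - 1\<close> and setting \<open>X = 1\<close> evaluates \<open>N\<close>.\<close>
  have "alternant n a ?X = alternant n (\<lambda>i. i) (\<lambda>i. ?X (a i))"
  proof -
    have "mat n n (\<lambda>(i, j). ?X j ^ a i) = transpose_mat (mat n n (\<lambda>(i, j). ?X (a j) ^ i))"
      by (rule eq_matI) (auto simp: monom_power mult.commute)
    then show ?thesis unfolding alternant_def by (simp add: det_transpose[of _ n])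
  qed
  then have "K * (\<Prod>j<n. \<Prod>i<j. q (a i) (a j)) = K * (\<Prod>j<n. \<Prod>i<j. q i j) * S"
    using S(2) prod_eq[of a] prod_eq[of "\<lambda>i. i"] a by (auto simp: alternant_id)
  moreover have "K \<noteq> 0"
  proof -
    have "?X 1 \<noteq> 1" by (simp add: monom_eq_1_iff)
    then show ?thesis by (simp add: K_def)
  qed
  ultimately have "(\<Prod>j<n. \<Prod>i<j. q (a i) (a j)) = (\<Prod>j<n. \<Prod>i<j. q i j) * S"
    by (simp add: mult.assoc)
  then have "poly (\<Prod>j<n. \<Prod>i<j. q (a i) (a j)) 1 = poly (\<Prod>j<n. \<Prod>i<j. q i j) 1 * int N"
    using S(1) by (metis poly_mult)
  moreover have q1: "poly (q k l) 1 = int l - int k" if "k \<le> l" for k l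
    using that by (simp add: q_def poly_sum poly_monom)
  have "poly (\<Prod>j<n. \<Prod>i<j. q (b i) (b j)) 1 = pair_diff_prod n (\<lambda>i. int (b i))"
    if "\<And>i j. i < j \<Longrightarrow> j < n \<Longrightarrow> b i < b j" for b
    unfolding pair_diff_prod_def poly_prod using that by (intro prod.cong refl) (auto intro!: q1 less_imp_le)
  ultimately show ?thesis using that[OF _ N] a by (simp add: mult.commute)
qed

section \<open>Principal minors of the Fourier matrix\<close>

lemma map_poly_of_int_add:
  "map_poly of_int (f + g) = map_poly of_int f + (map_poly of_int g :: 'a::ring_1 poly)"
  by (rule poly_eqI) (simp add: coeff_map_poly)

lemma map_poly_of_int_mult:
  "map_poly of_int (f * g) = map_poly of_int f * (map_poly of_int g :: 'a::comm_ring_1 poly)"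
  by (rule poly_eqI) (simp add: coeff_map_poly coeff_mult)

text \<open>The bound by \<open>Gamma_const\<close> in integral form. It covers all lengths
  \<open>n\<close>, including \<open>n < 2\<close> and \<open>n = r\<close>, which lie outside the
  range of the maximum.\<close>

definition vandermonde_quotients_less :: "nat \<Rightarrow> nat \<Rightarrow> bool" where
  "vandermonde_quotients_less r p \<longleftrightarrow> (\<forall>n a N.
     (\<forall>i j. i < j \<longrightarrow> j < n \<longrightarrow> a i < a j) \<longrightarrow> (\<forall>i<n. a i < r) \<longrightarrow>
     int N * pair_diff_prod n int = pair_diff_prod n (\<lambda>i. int (a i)) \<longrightarrow> N < p)"

context residue_char_valuation_ring
begin

text \<open>The factorization is made over integer polynomials with \<open>y j\<close> the monomial
  of exponent \<open>a j\<close>, where positivity makes sense, and is then carried to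
  \<open>x\<close> by evaluation. Neither factor lies in the prime ideal \<open>Q\<close>.\<close>

lemma fourier_minor_notin_Q:
  assumes r: "prime r" "r \<noteq> p" "residue_primroot r p"
    and x: "x ^ r = 1" "x \<noteq> 1"
    and a: "\<And>i j. i < j \<Longrightarrow> j < n \<Longrightarrow> a i < a j" "\<And>i. i < n \<Longrightarrow> a i < r"
    and bound: "vandermonde_quotients_less r p"
  shows "det (mat n n (\<lambda>(i, j). x ^ (a i * a j))) \<notin> Q"
proof -
  have xV: "x \<in> V" using root_of_unity_V[OF x(1)] r(1) prime_gt_0_nat by blast
  obtain N where N: "int N * pair_diff_prod n int = pair_diff_prod n (\<lambda>i. int (a i))"
    and fac: "\<And>y :: nat \<Rightarrow> int poly. (\<And>j. j < n \<Longrightarrow> nonneg_poly (y j) \<and> poly (y j) 1 = 1) \<Longrightarrow>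
      \<exists>S. nonneg_poly S \<and> poly S 1 = int N \<and> alternant n a y = pair_diff_prod n y * S"
    using alternant_factor[of n a] a(1) by metis
  define y where "y j = monom (1::int) (a j)" for j
  obtain S where S: "nonneg_poly S" "poly S 1 = int N" "alternant n a y = pair_diff_prod n y * S"
    using fac[of y] by (auto simp: y_def nonneg_poly_monom poly_monom)
  define ev where "ev h = poly (map_poly of_int h) x" for h :: "int poly"
  interpret ev: comm_ring_hom ev
    by unfold_locales (simp_all add: ev_def map_poly_of_int_add map_poly_of_int_mult)
  have ev_y: "ev (y j) = x ^ a j" for j
    by (simp add: ev_def y_def map_poly_monom poly_monom)
  have "det (mat n n (\<lambda>(i, j). x ^ (a i * a j))) = det (map_mat ev (mat n n (\<lambda>(i, j). y j ^ a i)))"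
    by (rule arg_cong[of _ _ det], rule eq_matI)
       (auto simp: ev.hom_power ev_y power_mult[symmetric] mult.commute)
  also have "\<dots> = ev (pair_diff_prod n y) * ev S"
    unfolding ev.hom_det using S(3) by (simp add: alternant_def ev.hom_mult)
  also have "ev (pair_diff_prod n y) = (\<Prod>j<n. \<Prod>i<j. x ^ a j - x ^ a i)"
    by (simp add: pair_diff_prod_def ev.hom_prod ev.hom_minus ev_y)
  finally have eq: "det (mat n n (\<lambda>(i, j). x ^ (a i * a j))) =
    (\<Prod>j<n. \<Prod>i<j. x ^ a j - x ^ a i) * ev S" .
  have diffV: "x ^ k - x ^ l \<in> V" for k l by (intro minus_V power_V xV)
  have diffQ: "x ^ a j - x ^ a i \<notin> Q" if "i < j" "j < n" for i j
  proof
    assume Q: "x ^ a j - x ^ a i \<in> Q"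
    have lt: "a i < a j" "a j < r" using a that by auto
    define d where "d = a j - a i"
    have d: "0 < d" "d < r" using lt by (auto simp: d_def)
    \<comment> \<open>Multiplying by \<open>x ^ (r - a i)\<close>, the inverse of
      \<open>x ^ a i\<close>, reduces the difference to a nontrivial root of unity minus
      \<open>1\<close>.\<close>
    have "x ^ (r - a i) * (x ^ a j - x ^ a i) = x ^ (r + d) - x ^ r"
      using lt by (simp add: algebra_simps d_def power_add[symmetric])
    also have "\<dots> = x ^ d - 1" using x by (simp add: power_add)
    finally have "x ^ d - 1 \<in> Q" using times_V_Q[OF power_V[OF xV] Q] by metis
    moreover have "(x ^ d) ^ r = 1" using x(1) by (metis mult.commute power_mult power_one)
    moreover have "x ^ d \<noteq> 1"
      using prime_root_of_unity_power_eq_1_iff[OF r(1) x] d nat_dvd_not_less by blast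
    ultimately show False using nontrivial_root_of_unity_not_cong_1 r by blast
  qed
  have "(\<Prod>j<n. \<Prod>i<j. x ^ a j - x ^ a i) \<notin> Q"
    by (rule prod_notin_Q, rule DiffI, rule prod_V, rule diffV, rule prod_notin_Q)
       (use diffV diffQ in auto)
  moreover have "ev S \<notin> Q"
    unfolding ev_def
  proof (rule nonneg_poly_at_root_of_unity_notin_Q[OF r x _ S(2)])
    show "coeff S i \<ge> 0" for i using S(1) by (simp add: nonneg_poly_def)
    show "N < p" using bound a N unfolding vandermonde_quotients_less_def by blast
    \<comment> \<open>\<open>N\<close> divides the Vandermonde product of the \<open>a i\<close>,
      whose factors lie strictly between \<open>0\<close> and \<open>r\<close>.\<close>
    show "\<not> r dvd N"
    proof
      assume "r dvd N"
      then have "int r dvd pair_diff_prod n (\<lambda>i. int (a i))"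
        unfolding N[symmetric] by simp
      then obtain j where j: "j < n" "int r dvd (\<Prod>i<j. int (a j) - int (a i))"
        using r(1) prime_dvd_prod_iff[of "{..<n}" "int r"] by (auto simp: pair_diff_prod_def)
      then obtain i where i: "i < j" "int r dvd int (a j) - int (a i)"
        using r(1) prime_dvd_prod_iff[of "{..<j}" "int r" "\<lambda>i. int (a j) - int (a i)"] by auto
      show False using zdvd_imp_le[OF i(2)] a(1)[OF i(1) j(1)] a(2)[OF j(1)] by simp
    qed
  qed
  moreover have "(\<Prod>j<n. \<Prod>i<j. x ^ a j - x ^ a i) \<in> V" by (intro prod_V diffV)
  moreover have "ev S \<in> V" unfolding ev_def by (rule poly_of_int_poly_V[OF xV])
  ultimately show ?thesis unfolding eq using prime_Q by blast
qed

section \<open>Linear systems over \<open>V\<close> modulo \<open>Q\<close>\<close>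

lemma det_V:
  assumes A: "A \<in> carrier_mat n n" and "\<And>i j. i < n \<Longrightarrow> j < n \<Longrightarrow> A $$ (i, j) \<in> V"
  shows "det A \<in> V"
  unfolding det_def'[OF A]
proof (intro sum_V times_V prod_V)
  fix \<pi> assume "\<pi> \<in> {\<pi>. \<pi> permutes {0..<n}}"
  then show "A $$ (i, \<pi> i) \<in> V" if "i \<in> {0..<n}" for i
    using that assms(2)[of i "\<pi> i"] permutes_in_image[of \<pi> "{0..<n}" i] by auto
qed (auto intro: of_int_V)

text \<open>Cramer's rule modulo \<open>Q\<close>: the system is multiplied by the adjugate, whose
  entries lie in \<open>V\<close>.\<close>

lemma det_times_solution_Q:
  assumes A: "A \<in> carrier_mat n n" and AV: "\<And>i j. i < n \<Longrightarrow> j < n \<Longrightarrow> A $$ (i, j) \<in> V"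
    and sys: "\<And>i. i < n \<Longrightarrow> (\<Sum>j<n. A $$ (i, j) * z j) \<in> Q"
    and k: "k < n"
  shows "det A * z k \<in> Q"
proof -
  have adjV: "adj_mat A $$ (k, i) \<in> V" if i: "i < n" for i
  proof -
    have "det (mat_delete A i k) \<in> V"
      by (rule det_V[of _ "n - 1"]) (use A AV i k in \<open>auto simp: mat_delete_def\<close>)
    then show ?thesis
      using A i k of_int_V[of "(-1) ^ (i + k)"] by (auto simp: adj_mat_def cofactor_def intro: times_V)
  qed
  have adj: "(\<Sum>i<n. adj_mat A $$ (k, i) * A $$ (i, j)) = (if k = j then det A else 0)" if "j < n" for j
  proof -
    have "(adj_mat A * A) $$ (k, j) = (\<Sum>i<n. adj_mat A $$ (k, i) * A $$ (i, j))"
      using adj_mat(1)[OF A] A k that by (auto simp: scalar_prod_def lessThan_atLeast0)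
    then show ?thesis using adj_mat(3)[OF A] k that by (cases "k = j") auto
  qed
  have "(\<Sum>i<n. adj_mat A $$ (k, i) * (\<Sum>j<n. A $$ (i, j) * z j)) =
      (\<Sum>i<n. \<Sum>j<n. adj_mat A $$ (k, i) * A $$ (i, j) * z j)"
    by (simp add: sum_distrib_left mult.assoc)
  also have "\<dots> = (\<Sum>j<n. (\<Sum>i<n. adj_mat A $$ (k, i) * A $$ (i, j)) * z j)"
    by (subst sum.swap) (simp add: sum_distrib_right)
  also have "\<dots> = (\<Sum>j<n. (if k = j then det A else 0) * z j)"
    by (rule sum.cong) (simp_all add: adj)
  also have "\<dots> = (\<Sum>j<n. if j = k then det A * z k else 0)"
    by (rule sum.cong) auto
  also have "\<dots> = det A * z k" using k by simp
  finally show ?thesis using sum_Q times_V_Q adjV sys by (metis (no_types, lifting) lessThan_iff)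
qed

text \<open>Equations and unknowns are indexed by the same set \<open>L\<close>, so listing it in
  increasing order makes the matrix a principal minor, whose determinant is not in
  \<open>Q\<close>.\<close>

lemma fourier_system_Q:
  assumes r: "prime r" "r \<noteq> p" "residue_primroot r p"
    and x: "x ^ r = 1" "x \<noteq> 1"
    and bound: "vandermonde_quotients_less r p"
    and L: "L \<subseteq> {..<r}"
    and z: "\<And>k. k \<in> L \<Longrightarrow> z k \<in> V"
    and sys: "\<And>l. l \<in> L \<Longrightarrow> (\<Sum>k\<in>L. x ^ (l * k) * z k) \<in> Q"
    and k: "k \<in> L"
  shows "z k \<in> Q"
proof -
  have xV: "x \<in> V" using root_of_unity_V[OF x(1)] r(1) prime_gt_0_nat by blast
  have fin: "finite L" using L finite_subset by blast
  define a where "a = (!) (sorted_list_of_set L)"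
  define n where "n = card L"
  have bij: "bij_betw a {..<n} L"
    unfolding a_def n_def
    by (rule bij_betw_nth) (use fin in auto)
  have mono: "a i < a j" if "i < j" "j < n" for i j
    using sorted_wrt_nth_less[OF strict_sorted_list_of_set, of i j L] that fin
    by (simp add: a_def n_def)
  have aL: "a i \<in> L" if "i < n" for i using bij that by (auto simp: bij_betw_def)
  have ar: "a i < r" if "i < n" for i using aL[OF that] L by auto
  define A where "A = mat n n (\<lambda>(i, j). x ^ (a i * a j))"
  have A: "A \<in> carrier_mat n n" by (simp add: A_def)
  have AV: "A $$ (i, j) \<in> V" if "i < n" "j < n" for i j
    using that xV by (simp add: A_def power_V)
  have detQ: "det A \<notin> Q"
    unfolding A_def by (rule fourier_minor_notin_Q[OF r x mono ar bound])
  have "(\<Sum>j<n. A $$ (i, j) * z (a j)) \<in> Q" if i: "i < n" for i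
  proof -
    have "(\<Sum>j<n. A $$ (i, j) * z (a j)) = (\<Sum>j<n. x ^ (a i * a j) * z (a j))"
      using i by (simp add: A_def)
    also have "\<dots> = (\<Sum>k\<in>L. x ^ (a i * k) * z k)"
      by (rule sum.reindex_bij_betw[OF bij])
    finally show ?thesis using sys[OF aL[OF i]] by simp
  qed
  from det_times_solution_Q[OF A AV this]
  have "det A * z (a i) \<in> Q" if "i < n" for i using that by blast
  moreover obtain i where "i < n" "a i = k" using bij k by (auto simp: bij_betw_def)
  ultimately have "det A * z k \<in> Q" by blast
  then show ?thesis using prime_Q[OF det_V[OF A AV] z[OF k]] detQ by blast
qed

end

text \<open>
  \<open>moment t f\<close> is the value at \<open>1\<close> of \<open>(X d/dX) ^ t\<close> applied to \<open>f\<close>; the moments with \<open>t < m\<close>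
  vanish on multiples of \<open>(X - 1) ^ m\<close>.
\<close>

definition moment :: "nat \<Rightarrow> 'a::field poly \<Rightarrow> 'a" where
  "moment t f = (\<Sum>e\<le>degree f. coeff f e * of_nat e ^ t)"

lemma moment_eq: "degree f < M \<Longrightarrow> moment t f = (\<Sum>e<M. coeff f e * of_nat e ^ t)"
  unfolding moment_def by (rule sum.mono_neutral_left) (auto simp: coeff_eq_0)

lemma moment_add: "moment t (f + g) = moment t f + moment t g"
proof -
  define M where "M = Suc (max (degree f) (degree g))"
  have "degree (f + g) < M" "degree f < M" "degree g < M"
    using degree_add_le_max[of f g] by (auto simp: M_def)
  then show ?thesis by (simp add: moment_eq algebra_simps sum.distrib)
qed

lemma moment_smult: "moment t (smult c f) = c * moment t f"
proof -
  have "degree (smult c f) < Suc (degree f)" using degree_smult_le[of c f] by simp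
  then show ?thesis by (simp add: moment_eq[of _ "Suc (degree f)"] sum_distrib_left mult.assoc del: sum.lessThan_Suc)
qed

lemma moment_sum:
  fixes f :: "'b \<Rightarrow> 'a::field poly"
  shows "moment t (\<Sum>i\<in>A. f i) = (\<Sum>i\<in>A. moment t (f i))"
proof (induction A rule: infinite_finite_induct)
  have "moment t (0 :: 'a poly) = 0" by (simp add: moment_def)
  then show "moment t (\<Sum>i\<in>{}. f i) = (\<Sum>i\<in>{}. moment t (f i))"
    "infinite A \<Longrightarrow> moment t (\<Sum>i\<in>A. f i) = (\<Sum>i\<in>A. moment t (f i))" for A by auto
qed (auto simp: moment_add)

lemma moment_monom: "moment t (monom c b) = c * of_nat b ^ t"
proof -
  have "degree (monom c b) < Suc b" using degree_monom_le[of c b] by simp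
  then have "moment t (monom c b) = (\<Sum>e<Suc b. (if e = b then c * of_nat b ^ t else 0))"
    unfolding moment_eq[OF \<open>degree (monom c b) < Suc b\<close>] by (intro sum.cong) auto
  then show ?thesis by simp
qed

lemma moment_pCons_0: "moment t (pCons 0 f) = (\<Sum>u\<le>t. of_nat (t choose u) * moment u f)"
proof -
  have "degree (pCons 0 f) < Suc (Suc (degree f))" using degree_pCons_le[of 0 f] by simp
  then have "moment t (pCons 0 f) = (\<Sum>e<Suc (degree f). coeff f e * (of_nat e + 1) ^ t)"
    by (simp add: moment_eq sum.lessThan_Suc_shift add.commute del: sum.lessThan_Suc)
  also have "\<dots> = (\<Sum>e<Suc (degree f). \<Sum>u\<le>t. of_nat (t choose u) * (coeff f e * of_nat e ^ u))"
    by (simp add: binomial_ring sum_distrib_left mult_ac del: sum.lessThan_Suc)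
  also have "\<dots> = (\<Sum>u\<le>t. of_nat (t choose u) * moment u f)"
    by (subst sum.swap) (simp add: sum_distrib_left moment_def lessThan_Suc_atMost)
  finally show ?thesis .
qed

text \<open>The term \<open>u = t\<close> of the shift by \<open>X\<close> merges with
  \<open>-c\<close>. For \<open>c\<close> congruent to \<open>1\<close> only lower moments of
  \<open>f\<close> remain modulo \<open>Q\<close>.\<close>

lemma moment_linear_factor:
  "moment t ([:-c, 1:] * f) = (\<Sum>u<t. of_nat (t choose u) * moment u f) + (1 - c) * moment t f"
proof -
  have "[:-c, 1:] * f = pCons 0 f + smult (-c) f" by simp
  then have "moment t ([:-c, 1:] * f) = moment t (pCons 0 f) + (- c) * moment t f"
    by (simp only: moment_add moment_smult)
  then show ?thesis
    by (simp add: moment_pCons_0 lessThan_Suc_atMost[symmetric] algebra_simps)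
qed

context valuation_ring
begin

lemma coeff_synthetic_div_V:
  assumes "c \<in> V" "\<And>i. coeff f i \<in> V"
  shows "coeff (synthetic_div f c) i \<in> V"
  using assms(2)
proof (induction f arbitrary: i)
  case (pCons a f)
  have f: "coeff f i \<in> V" for i using pCons.prems[of "Suc i"] by simp
  then have "poly f c \<in> V" using assms(1) by (auto simp: poly_altdef intro!: sum_V times_V power_V)
  then show ?case using pCons.IH[OF f] by (cases i) auto
qed (simp add: zero_V)

text \<open>Splitting off a factor \<open>X - w\<close> with \<open>w\<close> congruent to
  \<open>1\<close> expresses the moment of order \<open>t\<close>, modulo \<open>Q\<close>, by
  quotient moments of order below \<open>t\<close>. Each root thus gains one order.\<close>

lemma moment_Q:
  assumes "finite A" "\<And>w. w \<in> A \<Longrightarrow> w \<in> V \<and> w - 1 \<in> Q \<and> poly f w = 0"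
    and "\<And>e. coeff f e \<in> V" "t < card A"
  shows "moment t f \<in> Q"
  using assms
proof (induction A arbitrary: f t rule: finite_induct)
  case (insert w A)
  define q where "q = synthetic_div f w"
  have w: "w \<in> V" "w - 1 \<in> Q" "poly f w = 0" using insert.prems by auto
  have f: "f = [:-w, 1:] * q"
    using synthetic_div_correct'[of w f] w by (simp add: q_def)
  have qV: "coeff q e \<in> V" for e
    unfolding q_def by (intro coeff_synthetic_div_V w insert.prems)
  have IH: "moment u q \<in> Q" if "u < card A" for u
  proof (rule insert.IH[OF _ qV that])
    fix v assume v: "v \<in> A"
    then have "poly f v = 0" "v \<noteq> w" using insert by auto
    then have "poly q v = 0" by (simp add: f)
    then show "v \<in> V \<and> v - 1 \<in> Q \<and> poly q v = 0" using insert.prems v by auto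
  qed
  have "1 - w \<in> Q" using minus_Q[OF zero_Q w(2)] by simp
  moreover have "moment t q \<in> V"
    unfolding moment_def by (intro sum_V times_V qV power_V of_nat_V)
  ultimately have "(1 - w) * moment t q \<in> Q" by (rule times_Q_V)
  moreover have "(\<Sum>u<t. of_nat (t choose u) * moment u q) \<in> Q"
    using insert by (intro sum_Q times_V_Q of_nat_V IH) auto
  ultimately show ?case unfolding f moment_linear_factor by (rule add_Q[rotated])
qed simp

lemma coeff_times_V:
  "(\<And>i. coeff f i \<in> V) \<Longrightarrow> (\<And>i. coeff g i \<in> V) \<Longrightarrow> coeff (f * g) i \<in> V"
  by (auto simp: coeff_mult intro!: sum_V times_V)

lemma coeff_prod_V:
  "(\<And>a i. a \<in> A \<Longrightarrow> coeff (f a) i \<in> V) \<Longrightarrow> coeff (prod f A) i \<in> V"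
  by (induction A arbitrary: i rule: infinite_finite_induct)
     (auto intro!: coeff_times_V simp: coeff_pCons one_V zero_V one_pCons split: nat.split)

lemma coeff_linear_V: "coeff [:- of_nat b, 1:] i \<in> V"
  using of_nat_V[of b] minus_V[OF zero_V of_nat_V, of b]
  by (auto simp: coeff_pCons one_V zero_V split: nat.split)

end

section \<open>Recovering kernel coefficients modulo \<open>Q\<close> from their moments\<close>

context residue_char_valuation_ring
begin

text \<open>At order \<open>t\<close> an equation is available for each slice with more than
  \<open>t\<close> elements. The other slices are determined by lower moments, so the remaining
  system is square with equal row and column indices.\<close>

lemma moment_system_imp_moments_Q:
  assumes r: "prime r" "r \<noteq> p" "residue_primroot r p"
    and x: "x ^ r = 1" "x \<noteq> 1"
    and bound: "vandermonde_quotients_less r p"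
    and J: "\<And>k. k < r \<Longrightarrow> finite (J k)"
    and c: "\<And>k b. k < r \<Longrightarrow> b \<in> J k \<Longrightarrow> c k b \<in> V"
    and sys: "\<And>l t. l < r \<Longrightarrow> t < card (J l) \<Longrightarrow>
      (\<Sum>k<r. x ^ (l * k) * (\<Sum>b\<in>J k. c k b * of_nat b ^ t)) \<in> Q"
    and k: "k < r"
  shows "(\<Sum>b\<in>J k. c k b * of_nat b ^ t) \<in> Q"
  using k
proof (induction t arbitrary: k rule: less_induct)
  case (less t k)
  define T where "T k t = (\<Sum>b\<in>J k. c k b * of_nat b ^ t)" for k t
  have xV: "x \<in> V" using root_of_unity_V[OF x(1)] r(1) prime_gt_0_nat by blast
  have IH: "T k u \<in> Q" if "u < t" "k < r" for k u
    using less.IH that by (simp add: T_def)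
  \<comment> \<open>Slices with at most \<open>t\<close> elements: their moments satisfy a linear recurrence of order at most \<open>t\<close>.\<close>
  have small: "T k t \<in> Q" if k: "k < r" and card: "card (J k) \<le> t" for k
  proof -
    \<comment> \<open>Monic of degree exactly \<open>t\<close> and zero on \<open>J k\<close>; the
      monomial pads the degree from \<open>card (J k)\<close>.\<close>
    define g where "g = (\<Prod>b\<in>J k. [:- of_nat b, 1:]) * monom (1::'a) (t - card (J k))"
    have nz: "(\<Prod>b\<in>J k. [:- of_nat b, 1::'a:]) \<noteq> 0" using J[OF k] by simp
    have "degree (\<Prod>b\<in>J k. [:- of_nat b, 1::'a:]) = card (J k)"
      by (subst degree_prod_eq_sum_degree) auto
    then have deg: "degree g = t"
      unfolding g_def using nz card by (subst degree_mult_eq) (auto simp: degree_monom_eq)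
    have "lead_coeff g = 1"
      unfolding g_def lead_coeff_mult lead_coeff_prod by (simp add: degree_monom_eq)
    then have lead: "coeff g t = 1" using deg by simp
    have gV: "coeff g i \<in> V" for i
      unfolding g_def
      by (intro coeff_times_V coeff_prod_V coeff_linear_V) (auto simp: one_V zero_V)
    have "poly g (of_nat b) = 0" if "b \<in> J k" for b
      using J[OF k] that by (auto simp: g_def poly_prod)
    then have "0 = (\<Sum>b\<in>J k. c k b * poly g (of_nat b))" by simp
    also have "\<dots> = (\<Sum>e\<le>t. coeff g e * T k e)"
      unfolding poly_altdef deg T_def sum_distrib_left
      by (subst sum.swap) (simp add: mult_ac)
    also have "\<dots> = (\<Sum>e<t. coeff g e * T k e) + T k t"
      by (simp add: lessThan_Suc_atMost[symmetric] lead)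
    finally have "T k t = 0 - (\<Sum>e<t. coeff g e * T k e)" by (simp add: algebra_simps eq_neg_iff_add_eq_0)
    also have "\<dots> \<in> Q" using IH k by (intro minus_Q zero_Q sum_Q times_V_Q gV) auto
    finally show ?thesis .
  qed
  have "T k t \<in> Q"
  proof (cases "card (J k) \<le> t")
    case True
    then show ?thesis using small less.prems by blast
  next
    case False
    define L where "L = {k. k < r \<and> t < card (J k)}"
    show ?thesis
    proof (rule fourier_system_Q[OF r x bound, where L = L and z = "\<lambda>k. T k t"])
      show "L \<subseteq> {..<r}" "k \<in> L" using False less.prems by (auto simp: L_def)
      show "T k t \<in> V" if "k \<in> L" for k
        unfolding T_def using c that by (intro sum_V times_V power_V of_nat_V) (auto simp: L_def)
      show "(\<Sum>k\<in>L. x ^ (l * k) * T k t) \<in> Q" if l: "l \<in> L" for l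
      proof -
        have "(\<Sum>k<r. x ^ (l * k) * T k t) =
            (\<Sum>k\<in>{..<r} - L. x ^ (l * k) * T k t) + (\<Sum>k\<in>L. x ^ (l * k) * T k t)"
          by (rule sum.subset_diff) (auto simp: L_def)
        then have "(\<Sum>k\<in>L. x ^ (l * k) * T k t) =
            (\<Sum>k<r. x ^ (l * k) * T k t) - (\<Sum>k\<in>{..<r} - L. x ^ (l * k) * T k t)" by simp
        also have "\<dots> \<in> Q"
        proof (rule minus_Q)
          show "(\<Sum>k<r. x ^ (l * k) * T k t) \<in> Q"
            using sys l by (simp add: L_def T_def)
          show "(\<Sum>k\<in>{..<r} - L. x ^ (l * k) * T k t) \<in> Q"
            using small by (intro sum_Q times_V_Q power_V xV) (auto simp: L_def)
        qed
        finally show ?thesis .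
      qed
    qed
  qed
  then show ?case by (simp add: T_def)
qed

text \<open>Lagrange's argument: the polynomial vanishing at all other points isolates
  \<open>c b\<close>, multiplied by differences of distinct numbers below \<open>p\<close>, which
  are units modulo \<open>Q\<close>.\<close>

lemma coefficients_Q_of_moments_Q:
  assumes J: "J \<subseteq> {..<p}" and c: "\<And>b. b \<in> J \<Longrightarrow> c b \<in> V"
    and mom: "\<And>t. (\<Sum>b\<in>J. c b * of_nat b ^ t) \<in> Q"
    and b: "b \<in> J"
  shows "c b \<in> Q"
proof -
  have fin: "finite J" using J finite_subset by blast
  define g where "g = (\<Prod>b'\<in>J - {b}. [:- of_nat b', 1 :: 'a:])"
  have gV: "coeff g i \<in> V" for i
    unfolding g_def by (intro coeff_prod_V coeff_linear_V)
  have "c b * poly g (of_nat b) = (\<Sum>b'\<in>J. if b' = b then c b * poly g (of_nat b) else 0)"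
    using fin b by simp
  also have "\<dots> = (\<Sum>b'\<in>J. c b' * poly g (of_nat b'))"
  proof (rule sum.cong[OF refl])
    fix b' assume "b' \<in> J"
    then have "poly g (of_nat b') = 0" if "b' \<noteq> b"
      using that fin by (auto simp: g_def poly_prod)
    then show "(if b' = b then c b * poly g (of_nat b) else 0) = c b' * poly g (of_nat b')" by simp
  qed
  also have "\<dots> = (\<Sum>e\<le>degree g. coeff g e * (\<Sum>b'\<in>J. c b' * of_nat b' ^ e))"
    unfolding poly_altdef sum_distrib_left by (subst sum.swap) (simp add: mult_ac)
  also have "\<dots> \<in> Q" by (intro sum_Q times_V_Q gV mom)
  finally have Q: "c b * poly g (of_nat b) \<in> Q" .
  have g: "poly g (of_nat b) = (\<Prod>b'\<in>J - {b}. of_int (int b - int b'))"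
    by (simp add: g_def poly_prod)
  have "poly g (of_nat b) \<notin> Q"
    unfolding g
  proof (rule prod_notin_Q)
    fix b' assume b': "b' \<in> J - {b}"
    have "\<not> int p dvd int b - int b'"
    proof
      assume "int p dvd int b - int b'"
      then have "int p \<le> \<bar>int b - int b'\<bar>"
        using b' dvd_imp_le_int[of "int b - int b'" "int p"] by auto
      moreover have "b < p" "b' < p" using J b b' by auto
      ultimately show False by arith
    qed
    then show "of_int (int b - int b') \<in> V - Q" using of_int_V of_int_Q_iff by blast
  qed
  moreover have "poly g (of_nat b) \<in> V" unfolding g by (intro prod_V of_int_V)
  ultimately show ?thesis using prime_Q[OF c[OF b] _ Q] by blast
qed

text \<open>Triviality of the kernel in Chinese remainder coordinates: \<open>(a, l)\<close> indexes
  the equations and \<open>(b, k)\<close> the unknowns.\<close>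

theorem two_variable_fourier_system_trivial:
  fixes w x :: 'a
  assumes r: "prime r" "r \<noteq> p" "residue_primroot r p"
    and w: "w ^ p = 1" "w \<noteq> 1" and x: "x ^ r = 1" "x \<noteq> 1"
    and bound: "vandermonde_quotients_less r p"
    and I: "\<And>k. k < r \<Longrightarrow> I k \<subseteq> {..<p}" and J: "\<And>k. k < r \<Longrightarrow> J k \<subseteq> {..<p}"
    and card: "\<And>k. k < r \<Longrightarrow> card (I k) = card (J k)"
    and sys: "\<And>l a. l < r \<Longrightarrow> a \<in> I l \<Longrightarrow>
      (\<Sum>k<r. \<Sum>b\<in>J k. c k b * w ^ (a * b) * x ^ (l * k)) = 0"
    and kb: "k < r" "b \<in> J k"
  shows "c k b = 0"
proof (rule ccontr)
  assume nz: "c k b \<noteq> 0"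
  let ?A = "SIGMA k:{..<r}. J k"
  have finJ: "finite (J k)" if "k < r" for k using J[OF that] finite_subset by blast
  have "finite ?A" using finJ by auto
  moreover have "\<exists>i\<in>?A. (case i of (k, b) \<Rightarrow> c k b) \<noteq> 0" using nz kb by force
  \<comment> \<open>One scaled coefficient equals \<open>1\<close>; this is what finally contradicts
    all of them lying in \<open>Q\<close>.\<close>
  ultimately obtain d where
    "\<forall>i\<in>?A. d * (case i of (k, b) \<Rightarrow> c k b) \<in> V" "\<exists>i\<in>?A. d * (case i of (k, b) \<Rightarrow> c k b) = 1"
    by (rule scale_into_V)
  then have dV: "\<And>k b. k < r \<Longrightarrow> b \<in> J k \<Longrightarrow> d * c k b \<in> V"
    and ex1: "\<exists>k b. k < r \<and> b \<in> J k \<and> d * c k b = 1" by force+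
  have xV: "x \<in> V" using root_of_unity_V[OF x(1)] r(1) prime_gt_0_nat by blast
  have wV: "w \<in> V" using root_of_unity_V[OF w(1)] prime_p prime_gt_0_nat by blast
  have w1: "w - 1 \<in> Q" by (rule p_power_root_of_unity[OF w(1)])
  have w_inj: "inj_on (\<lambda>a. w ^ a) {..<p}"
  proof (rule linorder_inj_onI)
    fix a b assume ab: "a < b" "a \<in> {..<p}" "b \<in> {..<p}"
    have "w \<noteq> 0" using w(1) prime_gt_0_nat[OF prime_p] by (auto simp: power_0_left)
    show "w ^ a \<noteq> w ^ b"
    proof
      assume "w ^ a = w ^ b"
      then have "w ^ (b - a) = 1" using ab \<open>w \<noteq> 0\<close> by (simp add: power_diff)
      then have "p dvd b - a" using prime_root_of_unity_power_eq_1_iff[OF prime_p w] by blast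
      then show False using ab dvd_imp_le[of p "b - a"] by auto
    qed
  qed auto
  have mom: "(\<Sum>k<r. x ^ (l * k) * (\<Sum>b\<in>J k. d * c k b * of_nat b ^ t)) \<in> Q"
    if l: "l < r" and t: "t < card (J l)" for l t
  proof -
    \<comment> \<open>The equations with second index \<open>l\<close> say that \<open>f\<close>
      vanishes at \<open>w ^ a\<close> for \<open>a \<in> I l\<close>. These are
      \<open>card (J l)\<close> distinct points congruent to \<open>1\<close>.\<close>
    define f where "f = (\<Sum>k<r. \<Sum>b\<in>J k. monom (d * c k b * x ^ (l * k)) b)"
    have "moment t f \<in> Q"
    proof (rule moment_Q)
      show "finite ((\<lambda>a. w ^ a) ` I l)" using I[OF l] finite_subset by blast
      have "card ((\<lambda>a. w ^ a) ` I l) = card (I l)"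
        using inj_on_subset[OF w_inj I[OF l]] by (rule card_image)
      then show "t < card ((\<lambda>a. w ^ a) ` I l)" using t card[OF l] by simp
      show "coeff f e \<in> V" for e
        unfolding f_def coeff_sum
        by (intro sum_V) (auto intro!: times_V power_V xV zero_V dV)
      fix v assume "v \<in> (\<lambda>a. w ^ a) ` I l"
      then obtain a where a: "a \<in> I l" "v = w ^ a" by blast
      have "poly f v = d * (\<Sum>k<r. \<Sum>b\<in>J k. c k b * w ^ (a * b) * x ^ (l * k))"
        by (simp add: f_def poly_sum poly_monom a(2) sum_distrib_left power_mult[symmetric] mult_ac)
      then show "v \<in> V \<and> v - 1 \<in> Q \<and> poly f v = 0"
        using sys[OF l a(1)] a(2) power_V[OF wV] power_diff_one_Q[OF wV w1] by simp
    qed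
    moreover have "moment t f = (\<Sum>k<r. x ^ (l * k) * (\<Sum>b\<in>J k. d * c k b * of_nat b ^ t))"
      by (simp add: f_def moment_sum moment_monom sum_distrib_left mult_ac)
    ultimately show ?thesis by simp
  qed
  have "(\<Sum>b\<in>J k. d * c k b * of_nat b ^ t) \<in> Q" if "k < r" for k t
    using moment_system_imp_moments_Q[OF r x bound finJ dV mom that] by blast
  then have "d * c k b \<in> Q" if "k < r" "b \<in> J k" for k b
    using coefficients_Q_of_moments_Q[OF J[OF that(1)], where c = "\<lambda>b. d * c k b", OF dV[OF that(1)]] that
    by blast
  then show False using ex1 one_notin_Q by metis
qed

end

text \<open>Chevalley's theorem applied to the integer multiples of \<open>p\<close>.\<close>

lemma residue_char_valuation_ring_exists:
  assumes "prime p"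
  obtains V Q :: "'a::field_char_0 set" where "residue_char_valuation_ring V Q p"
proof -
  let ?S = "range (\<lambda>k. of_int (int p * k)) :: 'a set"
  have "nonunital_subring ?S"
    unfolding nonunital_subring_def
  proof (intro conjI ballI)
    show "0 \<in> ?S" by (rule image_eqI[of _ _ 0]) auto
    fix a b assume "a \<in> ?S" "b \<in> ?S"
    then obtain k l where kl: "a = of_int (int p * k)" "b = of_int (int p * l)" by blast
    show "a - b \<in> ?S" by (rule image_eqI[of _ _ "k - l"]) (simp_all add: kl algebra_simps)
    show "a * b \<in> ?S" by (rule image_eqI[of _ _ "k * int p * l"]) (simp_all add: kl)
  qed
  moreover have "1 \<notin> ?S"
  proof
    assume "1 \<in> ?S"
    then obtain k where "(1 :: 'a) = of_int (int p * k)" by (rule rangeE)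
    then have "int p * k = 1" by (metis of_int_1 of_int_eq_iff)
    then have "int p dvd 1" by (metis dvd_triv_left)
    then show False using prime_gt_1_nat[OF assms] by simp
  qed
  ultimately obtain V Q where VQ: "valuation_ring V Q" "?S \<subseteq> Q"
    by (rule valuation_ring_exists)
  have "of_nat p \<in> ?S" by (rule image_eqI[of _ _ 1]) auto
  then have "residue_char_valuation_ring V Q p"
    using VQ assms by (auto intro!: residue_char_valuation_ring.intro residue_char_valuation_ring_axioms.intro)
  then show ?thesis by (rule that)
qed

section \<open>Submatrices of the Fourier matrix of order \<open>p * r\<close>\<close>

text \<open>Inside the range of the maximum, \<open>N\<close> is one of the quotients compared.
  Outside it either the products are empty or \<open>a\<close> is forced to be the identity below
  \<open>n\<close>, so \<open>N = 1\<close>.\<close>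

lemma vandermonde_quotients_less_if_Gamma_const_less:
  assumes p: "p > 1" and Gamma: "real p > Gamma_const r"
  shows "vandermonde_quotients_less r p"
  unfolding vandermonde_quotients_less_def
proof (intro allI impI)
  fix n a N
  assume mono: "\<forall>i j. i < j \<longrightarrow> j < n \<longrightarrow> a i < a j" and ar: "\<forall>i<n. a i < r"
    and N: "int N * pair_diff_prod n int = pair_diff_prod n (\<lambda>i. int (a i))"
  have V0: "pair_diff_prod n int \<noteq> 0" by (simp add: pair_diff_prod_def)
  \<comment> \<open>Descending from the last index. For \<open>n\<close> at least \<open>r\<close>
    this and the bound \<open>i \<le> a i\<close> leave only \<open>a i = i\<close>.\<close>
  have upper: "a (n - Suc d) + d < r" if "d < n" for d
    using that
  proof (induction d)
    case (Suc d)
    then have "a (n - Suc (Suc d)) < a (n - Suc d)" using mono by (intro mono[rule_format]) auto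
    then show ?case using Suc by simp
  qed (use ar in auto)
  show "N < p"
  proof (cases "2 \<le> n \<and> n \<le> r - 1")
    case True
    let ?f = "\<lambda>a. vandermonde_det (map real a) / vandermonde_det (map real [0..<n])"
    let ?a = "map a [0..<n]"
    have real_V: "vandermonde_det (map real (map b [0..<n])) =
        real_of_int (pair_diff_prod n (\<lambda>i. int (b i)))" for b
      unfolding vandermonde_det_eq by (simp add: pair_diff_prod_def)
    have "?a \<in> increasing_tuples r n"
      using mono ar by (fastforce simp: increasing_tuples_def sorted_wrt_iff_nth_less)
    then have "?f ?a \<le> gamma_const r n"
      unfolding gamma_const_def by (intro Max_ge finite_imageI finite_increasing_tuples imageI)
    also have "\<dots> \<le> Gamma_const r"
      unfolding Gamma_const_def using True by (intro Max_ge) auto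
    also have "?f ?a = real N"
    proof -
      have "vandermonde_det (map real [0..<n]) = real_of_int (pair_diff_prod n int)"
        using real_V[of "\<lambda>i. i"] by simp
      then show ?thesis
        unfolding real_V N[symmetric] using V0 by simp
    qed
    finally show ?thesis using Gamma by simp
  next
    case False
    have "pair_diff_prod n (\<lambda>i. int (a i)) = pair_diff_prod n int"
    proof (cases "n \<le> 1")
      case True
      then have "n = 0 \<or> n = 1" by auto
      then show ?thesis by (auto simp: pair_diff_prod_def)
    next
      case False
      have lower: "i \<le> a i" if "i < n" for i
        using that
      proof (induction i)
        case (Suc i)
        then have "a i < a (Suc i)" by (intro mono[rule_format]) auto
        then show ?case using Suc by simp
      qed simp
      have "r \<le> n" using \<open>\<not> (2 \<le> n \<and> n \<le> r - 1)\<close> False by auto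
      then have "a i = i" if "i < n" for i
        using lower[OF that] upper[of "n - Suc i"] that by (simp add: Suc_diff_Suc)
      then show ?thesis unfolding pair_diff_prod_def by (intro prod.cong) auto
    qed
    then have "N = 1" using N V0 by simp
    then show ?thesis using p by simp
  qed
qed

text \<open>The rank of \<open>j\<close> in \<open>J\<close> is the index under which
  \<open>submatrix\<close> stores the row or column \<open>j\<close>.\<close>

lemma bij_betw_card_less:
  fixes J :: "nat set"
  assumes "finite J"
  shows "bij_betw (\<lambda>j. card {a \<in> J. a < j}) J {..<card J}"
proof -
  have less: "card {a \<in> J. a < i} < card {a \<in> J. a < j}" if "i \<in> J" "i < j" for i j
    using assms that by (intro psubset_card_mono) auto
  have "inj_on (\<lambda>j. card {a \<in> J. a < j}) J"
    by (rule linorder_inj_onI) (use less in \<open>auto simp: less_le\<close>)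
  moreover have "(\<lambda>j. card {a \<in> J. a < j}) ` J \<subseteq> {..<card J}"
    using assms by (auto intro!: psubset_card_mono)
  ultimately show ?thesis
    by (simp add: bij_betw_def card_image card_subset_eq)
qed

text \<open>Describes an \<open>r\<close>-slice by its \<open>p\<close>-components, using
  \<open>crt_iso\<close> itself rather than the inverse behind \<open>r_component\<close>.\<close>

definition slice_components :: "nat \<Rightarrow> nat \<Rightarrow> nat set \<Rightarrow> nat \<Rightarrow> nat set" where
  "slice_components p r S k = {a. a < p \<and> crt_iso p r (a, k) \<in> S}"

context
  fixes p r n :: nat
  assumes coprime: "coprime p r" and p: "p > 0" and r: "r > 0" and n: "n = p * r"
begin

private lemmas bij = bij_betw_crt_iso[OF coprime p r]

lemma r_component_crt_iso: "a < p \<Longrightarrow> k < r \<Longrightarrow> r_component p r (crt_iso p r (a, k)) = k"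
  using inv_into_f_f[OF bij_betw_imp_inj_on[OF bij], of "(a, k)"] by (simp add: r_component_def)

lemma crt_iso_cases:
  assumes "i < n"
  obtains a k where "a < p" "k < r" "i = crt_iso p r (a, k)"
proof -
  have "i \<in> crt_iso p r ` ({..<p} \<times> {..<r})"
    using assms bij_betw_imp_surj_on[OF bij] n by simp
  then show ?thesis using that by blast
qed

lemma card_slice_components:
  assumes "S \<subseteq> {..<n}" "k < r"
  shows "card (slice_components p r S k) = card (r_slice p r S k)"
proof (rule bij_betw_same_card[of "\<lambda>a. crt_iso p r (a, k)"])
  have "inj_on (\<lambda>a. crt_iso p r (a, k)) (slice_components p r S k)"
    using bij_betw_imp_inj_on[OF bij] assms(2) by (auto simp: inj_on_def slice_components_def)
  moreover have "(\<lambda>a. crt_iso p r (a, k)) ` slice_components p r S k = r_slice p r S k"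
  proof
    show "(\<lambda>a. crt_iso p r (a, k)) ` slice_components p r S k \<subseteq> r_slice p r S k"
      using assms by (auto simp: slice_components_def r_slice_def r_component_crt_iso)
    show "r_slice p r S k \<subseteq> (\<lambda>a. crt_iso p r (a, k)) ` slice_components p r S k"
    proof
      fix i assume i: "i \<in> r_slice p r S k"
      then have "i \<in> S" "r_component p r i = k" by (auto simp: r_slice_def)
      moreover from this assms have "i < n" by auto
      then obtain a l where "a < p" "l < r" "i = crt_iso p r (a, l)" by (rule crt_iso_cases)
      ultimately show "i \<in> (\<lambda>a. crt_iso p r (a, k)) ` slice_components p r S k"
        by (auto simp: slice_components_def r_component_crt_iso)
    qed
  qed
  ultimately show "bij_betw (\<lambda>a. crt_iso p r (a, k)) (slice_components p r S k) (r_slice p r S k)"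
    by (simp add: bij_betw_def)
qed

lemma sum_slice_components:
  assumes "S \<subseteq> {..<n}"
  shows "(\<Sum>i\<in>S. f i) = (\<Sum>k<r. \<Sum>a\<in>slice_components p r S k. f (crt_iso p r (a, k)))"
proof -
  have "bij_betw (\<lambda>(k, a). crt_iso p r (a, k)) (SIGMA k:{..<r}. slice_components p r S k) S"
    unfolding bij_betw_def
  proof
    show "inj_on (\<lambda>(k, a). crt_iso p r (a, k)) (SIGMA k:{..<r}. slice_components p r S k)"
      using bij_betw_imp_inj_on[OF bij] by (auto simp: inj_on_def slice_components_def)
    show "(\<lambda>(k, a). crt_iso p r (a, k)) ` (SIGMA k:{..<r}. slice_components p r S k) = S"
    proof
      show "S \<subseteq> (\<lambda>(k, a). crt_iso p r (a, k)) ` (SIGMA k:{..<r}. slice_components p r S k)"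
      proof
        fix i assume i: "i \<in> S"
        then have "i < n" using assms by auto
        then obtain a k where "a < p" "k < r" "i = crt_iso p r (a, k)" by (rule crt_iso_cases)
        then show "i \<in> (\<lambda>(k, a). crt_iso p r (a, k)) ` (SIGMA k:{..<r}. slice_components p r S k)"
          using i by (auto simp: slice_components_def intro!: image_eqI[of _ _ "(k, a)"])
      qed
    qed (auto simp: slice_components_def)
  qed
  from sum.reindex_bij_betw[OF this, of f]
  have "(\<Sum>i\<in>S. f i) = (\<Sum>(k, a)\<in>(SIGMA k:{..<r}. slice_components p r S k). f (crt_iso p r (a, k)))"
    by (simp add: case_prod_unfold)
  also have "\<dots> = (\<Sum>k<r. \<Sum>a\<in>slice_components p r S k. f (crt_iso p r (a, k)))"
    by (rule sum.Sigma[symmetric]) (auto simp: slice_components_def)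
  finally show ?thesis .
qed

lemma card_eq_if_card_r_slices_eq:
  assumes "S \<subseteq> {..<n}" "T \<subseteq> {..<n}"
    and "\<And>k. k < r \<Longrightarrow> card (r_slice p r S k) = card (r_slice p r T k)"
  shows "card S = card T"
proof -
  have "card X = (\<Sum>k<r. card (r_slice p r X k))" if "X \<subseteq> {..<n}" for X
    using sum_slice_components[OF that, of "\<lambda>_. 1 :: nat"] card_slice_components[OF that] by simp
  then show ?thesis using assms by simp
qed

text \<open>In \<open>(r * a + p * l) * (r * b + p * k)\<close> the cross terms are multiples of
  \<open>n = p * r\<close>, so the two coordinates separate.\<close>

lemma power_crt_iso_mult:
  fixes z :: "'a::comm_monoid_mult"
  assumes "z ^ n = 1"
  shows "z ^ (crt_iso p r (a, l) * crt_iso p r (b, k)) = (z ^ (r * r)) ^ (a * b) * (z ^ (p * p)) ^ (l * k)"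
proof -
  have z_mod: "z ^ (m mod n) = z ^ m" for m
    using assms by (metis (no_types) mult_div_mod_eq power_add power_mult power_one mult_1)
  have "z ^ (crt_iso p r (a, l) * crt_iso p r (b, k)) = z ^ ((r * a + p * l) * (r * b + p * k))"
    using z_mod[of "crt_iso p r (a, l) * crt_iso p r (b, k)"] z_mod[of "(r * a + p * l) * (r * b + p * k)"]
    by (simp add: crt_iso_def n mod_mult_eq)
  also have "(r * a + p * l) * (r * b + p * k) = r * r * (a * b) + p * p * (l * k) + n * (a * k + l * b)"
    by (simp add: n algebra_simps)
  also have "z ^ \<dots> = (z ^ (r * r)) ^ (a * b) * (z ^ (p * p)) ^ (l * k) * (z ^ n) ^ (a * k + l * b)"
    by (simp only: power_add power_mult)
  finally show ?thesis by (simp add: assms)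
qed

end

lemma primitive_root_of_unity_power_eq_1:
  assumes "primitive_root_of_unity n z" "n > 0" "z ^ m = 1"
  shows "n dvd m"
proof (rule ccontr)
  assume "\<not> n dvd m"
  then have "0 < m mod n" "m mod n < n" using assms(2) by (auto simp: dvd_eq_mod_eq_0)
  moreover have "z ^ (m mod n) = 1"
  proof -
    have "z ^ m = (z ^ n) ^ (m div n) * z ^ (m mod n)"
      by (simp only: power_mult[symmetric] power_add[symmetric] mult_div_mod_eq)
    then show ?thesis using assms by (simp add: primitive_root_of_unity_def)
  qed
  ultimately show False using assms(1) by (auto simp: primitive_root_of_unity_def)
qed

text \<open>A kernel vector of the square submatrix is reindexed by the elements of \<open>J\<close>
  through their ranks.\<close>

lemma det_submatrix_0_imp_kernel:
  fixes A :: "'a::field mat"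
  assumes A: "A \<in> carrier_mat n n" and IJ: "I \<subseteq> {..<n}" "J \<subseteq> {..<n}" "card I = card J"
    and det: "det (submatrix A I J) = 0"
  obtains u where "\<exists>j\<in>J. u j \<noteq> 0" "\<And>i. i \<in> I \<Longrightarrow> (\<Sum>j\<in>J. A $$ (i, j) * u j) = 0"
proof -
  have fin: "finite I" "finite J" using IJ finite_subset by blast+
  have sets: "{i. i < n \<and> i \<in> I} = I" "{j. j < n \<and> j \<in> J} = J" using IJ by auto
  let ?B = "submatrix A I J" and ?N = "card J"
  have B: "?B \<in> carrier_mat ?N ?N"
    using A sets IJ(3) by (intro carrier_matI) (simp_all add: dim_submatrix)
  then obtain v where v: "v \<in> carrier_vec ?N" "v \<noteq> 0\<^sub>v ?N" "?B *\<^sub>v v = 0\<^sub>v ?N"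
    using det det_0_iff_vec_prod_zero_field[OF B] by blast
  let ?idx = "\<lambda>S j. card {a \<in> S. a < j}"
  note bijJ = bij_betw_card_less[OF fin(2)] and bijI = bij_betw_card_less[OF fin(1)]
  show ?thesis
  proof (rule that[of "\<lambda>j. v $ ?idx J j"])
    show "\<exists>j\<in>J. v $ ?idx J j \<noteq> 0"
    proof (rule ccontr)
      assume neg: "\<not> ?thesis"
      have "v $ m = 0" if "m < ?N" for m
      proof -
        have "m \<in> ?idx J ` J" using bijJ that by (auto simp: bij_betw_def)
        then show ?thesis using neg by auto
      qed
      then have "v = 0\<^sub>v ?N" using v(1) by (intro eq_vecI) auto
      then show False using v(2) by blast
    qed
    fix i assume i: "i \<in> I"
    then have iN: "?idx I i < ?N" using bijI IJ(3) by (auto simp: bij_betw_def)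
    have "(\<Sum>j\<in>J. A $$ (i, j) * v $ ?idx J j) = (\<Sum>j\<in>J. ?B $$ (?idx I i, ?idx J j) * v $ ?idx J j)"
    proof (rule sum.cong[OF refl])
      fix j assume j: "j \<in> J"
      have "i < dim_row A" "j < dim_col A" using i j IJ A by auto
      from submatrix_index_card[OF this i j]
      show "A $$ (i, j) * v $ ?idx J j = ?B $$ (?idx I i, ?idx J j) * v $ ?idx J j" by simp
    qed
    also have "\<dots> = (\<Sum>m<?N. ?B $$ (?idx I i, m) * v $ m)"
      by (rule sum.reindex_bij_betw[OF bijJ])
    also have "\<dots> = (?B *\<^sub>v v) $ ?idx I i"
      using B v(1) iN by (auto simp: scalar_prod_def lessThan_atLeast0)
    also have "\<dots> = 0" using v(3) iN by simp
    finally show "(\<Sum>j\<in>J. A $$ (i, j) * v $ ?idx J j) = 0" .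
  qed
qed

theorem theoremB:
  fixes p r n :: nat and \<zeta> :: complex and I J :: "nat set"
  assumes "prime p" and "odd p"
    and "prime r" and "odd r"
    and "p \<noteq> r"
    and "n = p * r"
    and "residue_primroot r p"
    and "real p > Gamma_const r"
    and "primitive_root_of_unity n \<zeta>"
    and "I \<subseteq> {..<n}" and "J \<subseteq> {..<n}"
    and "\<forall>k\<in>{0..r - 1}. card (r_slice p r I k) = card (r_slice p r J k)"
  shows "det (submatrix (fourier_mat n \<zeta>) I J) \<noteq> 0"
proof
  assume det0: "det (submatrix (fourier_mat n \<zeta>) I J) = 0"
  have p: "p > 1" and r: "r > 1" using assms(1,3) prime_gt_1_nat by blast+
  then have p0: "p > 0" and r0: "r > 0" and n0: "n > 0" using assms(6) by auto
  have cop: "coprime p r" using assms(1,3,5) by (simp add: primes_coprime)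
  note crt = cop p0 r0 assms(6)
  have z: "\<zeta> ^ n = 1" using assms(9) by (simp add: primitive_root_of_unity_def)
  have slices: "card (r_slice p r I k) = card (r_slice p r J k)" if "k < r" for k
    using assms(12) that by auto
  have card: "card I = card J"
    using card_eq_if_card_r_slices_eq[OF crt assms(10,11) slices] .
  have F: "fourier_mat n \<zeta> \<in> carrier_mat n n" by (simp add: fourier_mat_def)
  obtain u where u: "\<exists>j\<in>J. u j \<noteq> 0"
    and ker: "\<And>i. i \<in> I \<Longrightarrow> (\<Sum>j\<in>J. fourier_mat n \<zeta> $$ (i, j) * u j) = 0"
    using det_submatrix_0_imp_kernel[OF F assms(10,11) card det0] by metis
  \<comment> \<open>The exponents are squares because row and column index each contribute a factor
    \<open>r\<close>, respectively \<open>p\<close>.\<close>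
  define w where "w = \<zeta> ^ (r * r)"
  define x where "x = \<zeta> ^ (p * p)"
  have not_dvd: "\<not> p dvd r" "\<not> r dvd p"
    using assms(1,3,5) primes_dvd_imp_eq by blast+
  have w: "w ^ p = 1" "w \<noteq> 1"
  proof -
    have "w ^ p = (\<zeta> ^ n) ^ r" by (simp add: w_def assms(6) power_mult[symmetric] mult_ac)
    then show "w ^ p = 1" by (simp add: z)
    show "w \<noteq> 1"
    proof
      assume "w = 1"
      then have "p * r dvd r * r"
        using primitive_root_of_unity_power_eq_1[OF assms(9) n0, of "r * r"] assms(6) by (simp add: w_def)
      then show False using not_dvd r0 by simp
    qed
  qed
  have x: "x ^ r = 1" "x \<noteq> 1"
  proof -
    have "x ^ r = (\<zeta> ^ n) ^ p" by (simp add: x_def assms(6) power_mult[symmetric] mult_ac)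
    then show "x ^ r = 1" by (simp add: z)
    show "x \<noteq> 1"
    proof
      assume "x = 1"
      then have "p * r dvd p * p"
        using primitive_root_of_unity_power_eq_1[OF assms(9) n0, of "p * p"] assms(6) by (simp add: x_def)
      then show False using not_dvd p0 by simp
    qed
  qed
  \<comment> \<open>Any valuation ring of this kind will do: the kernel statement taken from the
    locale mentions neither \<open>V\<close> nor \<open>Q\<close>.\<close>
  obtain V Q :: "complex set" where "residue_char_valuation_ring V Q p"
    using residue_char_valuation_ring_exists[OF assms(1)] by blast
  then interpret residue_char_valuation_ring V Q p .
  let ?C = "slice_components p r"
  have zero: "u (crt_iso p r (b, k)) = 0" if "k < r" "b \<in> ?C J k" for k b
  proof (rule two_variable_fourier_system_trivial[where c = "\<lambda>k b. u (crt_iso p r (b, k))" and I = "?C I" and J = "?C J"])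
    show "vandermonde_quotients_less r p"
      using vandermonde_quotients_less_if_Gamma_const_less[OF p assms(8)] .
    show "card (?C I k) = card (?C J k)" if "k < r" for k
      using card_slice_components[OF crt] assms(10,11) slices that by simp
    fix l a assume la: "l < r" "a \<in> ?C I l"
    let ?i = "crt_iso p r (a, l)"
    have i: "?i \<in> I" using la by (simp add: slice_components_def)
    have "0 = (\<Sum>j\<in>J. \<zeta> ^ (?i * j) * u j)"
    proof -
      have "(\<Sum>j\<in>J. fourier_mat n \<zeta> $$ (?i, j) * u j) = (\<Sum>j\<in>J. \<zeta> ^ (?i * j) * u j)"
      proof (rule sum.cong[OF refl])
        fix j assume "j \<in> J"
        then have "?i < n" "j < n" using i assms(10,11) by blast+
        then show "fourier_mat n \<zeta> $$ (?i, j) * u j = \<zeta> ^ (?i * j) * u j"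
          by (simp add: fourier_mat_def)
      qed
      then show ?thesis using ker[OF i] by simp
    qed
    also have "\<dots> = (\<Sum>k<r. \<Sum>b\<in>?C J k. u (crt_iso p r (b, k)) * w ^ (a * b) * x ^ (l * k))"
      unfolding sum_slice_components[OF crt assms(11)]
      by (simp add: power_crt_iso_mult[OF crt z] w_def x_def mult_ac)
    finally show "(\<Sum>k<r. \<Sum>b\<in>?C J k. u (crt_iso p r (b, k)) * w ^ (a * b) * x ^ (l * k)) = 0" by simp
  qed (use assms w x that in \<open>auto simp: slice_components_def\<close>)
  obtain j where j: "j \<in> J" "u j \<noteq> 0" using u by blast
  then have "j < n" using assms(11) by auto
  then obtain b k where "b < p" "k < r" "j = crt_iso p r (b, k)"
    by (rule crt_iso_cases[OF crt])
  then show False using zero[of k b] j by (simp add: slice_components_def)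
qed

end
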